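(* If $G$ is a nice planar graph with girth $g(G) \geq 16$, then $\mathrm{ch}_\Pi^*(G) \leq 4$.
   Context: Graphs are finite and simple. A graph is nice if it has no connected component isomorphic to $K_2$. The girth $g(G)$ is the length of a shortest cycle of $G$, with $g(G)=\infty$ if $G$ has no cycle. A $k$-list assignment $L$ of $G$ assigns to every edge $e \in E(G)$ a set $L(e)$ of $k$ real numbers. An $L$-labelling is a map $\ell$ on $E(G)$ with $\ell(e) \in L(e)$ for every edge $e$. For a vertex $v$, set $\pi_\ell(v)=\prod_{w \in N(v)} \ell(vw)$. The labelling $\ell$ is p-proper if $\pi_\ell(u) \neq \pi_\ell(v)$ for every edge $uv$. $\mathrm{ch}_\Pi^*(G)$ is the smallest $k \geq 1$, if any, such that $G$ admits a p-proper $L$-labelling for every $k$-list assignment $L$ with $0 \notin L(e)$ for every edge $e$. *)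

theory Defs
  imports "HOL-Analysis.Analysis" "HOL-Library.Extended_Nat"
begin

section \<open>Finite simple graphs\<close>

record 'a ugraph =
  verts :: "'a set"
  edges :: "'a set set"

definition simple_graph :: "'a ugraph \<Rightarrow> bool" where
  "simple_graph G \<longleftrightarrow>
     finite (verts G) \<and> (\<forall>e\<in>edges G. e \<subseteq> verts G \<and> card e = 2)"

definition neighbours :: "'a ugraph \<Rightarrow> 'a \<Rightarrow> 'a set" where
  "neighbours G v = {w. {v, w} \<in> edges G}"

definition induced_subgraph :: "'a ugraph \<Rightarrow> 'a set \<Rightarrow> 'a ugraph" where
  "induced_subgraph G U = \<lparr>verts = U, edges = {e \<in> edges G. e \<subseteq> U}\<rparr>"

definition graph_iso :: "'a ugraph \<Rightarrow> 'b ugraph \<Rightarrow> bool" where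
  "graph_iso G H \<longleftrightarrow> (\<exists>f. bij_betw f (verts G) (verts H) \<and>
     (\<forall>u\<in>verts G. \<forall>v\<in>verts G. {u, v} \<in> edges G \<longleftrightarrow> {f u, f v} \<in> edges H))"

definition complete_graph :: "nat \<Rightarrow> nat ugraph" where
  "complete_graph n = \<lparr>verts = {..<n}, edges = {e. e \<subseteq> {..<n} \<and> card e = 2}\<rparr>"

definition component_of :: "'a ugraph \<Rightarrow> 'a \<Rightarrow> 'a ugraph" where
  "component_of G v = induced_subgraph G {w. (v, w) \<in> {(x, y). {x, y} \<in> edges G}\<^sup>*}"

definition components_of_graph :: "'a ugraph \<Rightarrow> 'a ugraph set" where
  "components_of_graph G = component_of G ` verts G"

definition nice :: "'a ugraph \<Rightarrow> bool" where
  "nice G \<longleftrightarrow> (\<forall>C\<in>components_of_graph G. \<not> graph_iso C (complete_graph 2))"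

text \<open>A cycle is given by the list of its vertices, in cyclic order and without
  repeating the first one; its length is thus the length of the list.\<close>

definition is_cycle :: "'a ugraph \<Rightarrow> 'a list \<Rightarrow> bool" where
  "is_cycle G c \<longleftrightarrow> 3 \<le> length c \<and> distinct c \<and> set c \<subseteq> verts G \<and>
     (\<forall>i<length c. {c ! i, c ! (Suc i mod length c)} \<in> edges G)"

text \<open>The infimum of the empty set of extended naturals is \<open>\<infinity>\<close>.\<close>

definition girth :: "'a ugraph \<Rightarrow> enat" where
  "girth G = Inf {enat (length c) | c. is_cycle G c}"

section \<open>Planarity\<close>

text \<open>A drawing in the plane, identified with the complex numbers: \<open>p\<close> places the
  vertices and \<open>\<gamma>\<close> draws each edge as an arc joining its two ends, such that the interior
  of an edge contains no vertex and no point of any other edge.\<close>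

definition plane_drawing ::
    "'a ugraph \<Rightarrow> ('a \<Rightarrow> complex) \<Rightarrow> ('a set \<Rightarrow> real \<Rightarrow> complex) \<Rightarrow> bool" where
  "plane_drawing G p \<gamma> \<longleftrightarrow>
     inj_on p (verts G) \<and>
     (\<forall>e\<in>edges G. arc (\<gamma> e) \<and> {pathstart (\<gamma> e), pathfinish (\<gamma> e)} = p ` e) \<and>
     (\<forall>e\<in>edges G. (path_image (\<gamma> e) - p ` e) \<inter> p ` verts G = {}) \<and>
     (\<forall>e\<in>edges G. \<forall>f\<in>edges G. e \<noteq> f \<longrightarrow>
        (path_image (\<gamma> e) - p ` e) \<inter> path_image (\<gamma> f) = {})"

definition planar :: "'a ugraph \<Rightarrow> bool" where
  "planar G \<longleftrightarrow> (\<exists>p \<gamma>. plane_drawing G p \<gamma>)"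

section \<open>Product-proper list labellings\<close>

definition list_assignment :: "'a ugraph \<Rightarrow> nat \<Rightarrow> ('a set \<Rightarrow> real set) \<Rightarrow> bool" where
  "list_assignment G k L \<longleftrightarrow> (\<forall>e\<in>edges G. finite (L e) \<and> card (L e) = k)"

definition list_labelling ::
    "'a ugraph \<Rightarrow> ('a set \<Rightarrow> real set) \<Rightarrow> ('a set \<Rightarrow> real) \<Rightarrow> bool" where
  "list_labelling G L l \<longleftrightarrow> (\<forall>e\<in>edges G. l e \<in> L e)"

definition vertex_product :: "'a ugraph \<Rightarrow> ('a set \<Rightarrow> real) \<Rightarrow> 'a \<Rightarrow> real" where
  "vertex_product G l v = (\<Prod>w\<in>neighbours G v. l {v, w})"

definition p_proper :: "'a ugraph \<Rightarrow> ('a set \<Rightarrow> real) \<Rightarrow> bool" where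
  "p_proper G l \<longleftrightarrow>
     (\<forall>u v. {u, v} \<in> edges G \<longrightarrow> vertex_product G l u \<noteq> vertex_product G l v)"

text \<open>The value is \<open>\<infinity>\<close> when no suitable \<open>k\<close> exists.\<close>

definition ch_prod_nonzero :: "'a ugraph \<Rightarrow> enat" where
  "ch_prod_nonzero G = Inf {enat k | k. 1 \<le> k \<and>
     (\<forall>L. list_assignment G k L \<and> (\<forall>e\<in>edges G. 0 \<notin> L e) \<longrightarrow>
        (\<exists>l. list_labelling G L l \<and> p_proper G l))}"

end

theory Submission
  imports Defs
begin

text \<open>
  Argue by induction on the edge set, exempting isolated edges, so that any set of edges can be
  deleted. If a vertex \<open>w\<close> has at most two neighbours beyond its leaves and pendant paths of length
  two, and carries two leaves or a pendant path, those leaves and paths are deleted and relabelled.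
  With many leaves this needs labels \<open>g i\<close> whose product avoids each \<open>g i\<close> and two further values;
  in logarithms these are affine conditions, handled by the Combinatorial Nullstellensatz.
  Otherwise the vertices with at least two remaining edges span a subgraph of minimum degree two.
  By planarity and the girth bound it contains three consecutive vertices of degree two, each with
  at most one leaf in the whole graph, and the two edges between them and their leaf edges are
  relabelled.

  Planarity enters through the faces, the components of the complement of the drawing: there are at
  least \<open>|E| - |V| + 2\<close> of them, the boundary of each one contains a cycle, and an edge on a cycle
  bounds at most two faces. These three facts follow from the Jordan curve theorem and Janiszewski's
  theorem.
\<close>

section \<open>Cycles and acyclic edge sets\<close>

text \<open>The girth bound is governed by the number six. Let D be the degree sum over the branch
  vertices B of a subgraph of minimum degree two. Then |E| - |V| = D / 2 - |B| \<ge> D / 6, so there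
  are at least D / 6 + 2 faces. Their cycles pass through branch vertices at most D times in total,
  so some face cycle has at most five of them, and a cycle of length at least 16 with so few must
  contain three consecutive vertices of degree two. The list size four is used up in two places. On
  the path of three vertices a new label has up to three values to avoid. At a vertex with many
  leaves every leaf label is a factor of the product from which it must differ, so the conditions do
  not separate into one per label; there a list of four nonzero reals may have only two absolute
  values, and logarithms forget signs. A reducible vertex may keep two other edges, since their far
  ends prescribe two values that its product must avoid. Pendant paths are stripped along with
  leaves so that a single round of stripping already reaches minimum degree two.\<close>

definition inc :: "'a set set \<Rightarrow> 'a \<Rightarrow> 'a set set" where
  "inc E v = {e \<in> E. v \<in> e}"

fun path_edges :: "'a list \<Rightarrow> 'a set set" where
  "path_edges (x # y # xs) = insert {x, y} (path_edges (y # xs))"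
| "path_edges _ = {}"

definition cycle_edges :: "'a list \<Rightarrow> 'a set set" where
  "cycle_edges c = insert {last c, hd c} (path_edges c)"

text \<open>Cycles live in an arbitrary edge set instead of a graph, because face boundaries,
  maximal acyclic sets and the stripped subgraph all occur as mere sets of edges.\<close>

definition cycle_in :: "'a set set \<Rightarrow> 'a list \<Rightarrow> bool" where
  "cycle_in E c \<longleftrightarrow> distinct c \<and> 3 \<le> length c \<and> cycle_edges c \<subseteq> E"

lemma finite_inc [simp]: "finite E \<Longrightarrow> finite (inc E v)"
  by (simp add: inc_def)

lemma cycle_in_mono: "cycle_in E c \<Longrightarrow> E \<subseteq> E' \<Longrightarrow> cycle_in E' c"
  by (auto simp: cycle_in_def)

lemma path_edges_conv_nth:
  "path_edges xs = {{xs ! i, xs ! Suc i} |i. Suc i < length xs}"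
proof (induction xs rule: path_edges.induct)
  case (1 x y xs)
  show ?case
  proof (intro equalityI subsetI)
    fix e assume "e \<in> path_edges (x # y # xs)"
    then consider "e = {x, y}" | "e \<in> path_edges (y # xs)" by auto
    then show "e \<in> {{(x # y # xs) ! i, (x # y # xs) ! Suc i} |i. Suc i < length (x # y # xs)}"
    proof cases
      case 1 then show ?thesis by (intro CollectI exI[of _ 0]) simp
    next
      case 2
      then obtain i where "e = {(y # xs) ! i, (y # xs) ! Suc i}" "Suc i < length (y # xs)"
        using "1.IH" by blast
      then show ?thesis by (intro CollectI exI[of _ "Suc i"]) simp
    qed
  next
    fix e assume "e \<in> {{(x # y # xs) ! i, (x # y # xs) ! Suc i} |i. Suc i < length (x # y # xs)}"
    then obtain i where i: "e = {(x # y # xs) ! i, (x # y # xs) ! Suc i}"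
      "Suc i < length (x # y # xs)" by blast
    show "e \<in> path_edges (x # y # xs)"
    proof (cases i)
      case 0 then show ?thesis using i by simp
    next
      case (Suc j)
      then have "e = {(y # xs) ! j, (y # xs) ! Suc j}" "Suc j < length (y # xs)" using i by auto
      then have "e \<in> path_edges (y # xs)" unfolding "1.IH" by blast
      then show ?thesis by simp
    qed
  qed
qed auto

lemma finite_path_edges: "finite (path_edges xs)"
  by (induction xs rule: path_edges.induct) auto

lemma Union_path_edges_subset: "\<Union> (path_edges xs) \<subseteq> set xs"
  by (induction xs rule: path_edges.induct) auto

lemma path_edges_append:
  "xs \<noteq> [] \<Longrightarrow> ys \<noteq> [] \<Longrightarrow>
    path_edges (xs @ ys) = path_edges xs \<union> insert {last xs, hd ys} (path_edges ys)"
proof (induction xs rule: path_edges.induct)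
  case ("2_2" x)
  then show ?case by (cases ys) auto
qed auto

lemma path_edges_Cons: "ys \<noteq> [] \<Longrightarrow> path_edges (x # ys) = insert {x, hd ys} (path_edges ys)"
  by (cases ys) auto

section \<open>Rotating cycles\<close>

lemma cycle_edges_rotate1: "cycle_edges (rotate1 c) = cycle_edges c"
proof (cases c)
  case (Cons x xs)
  show ?thesis
  proof (cases "xs = []")
    case False
    then show ?thesis
      using Cons by (auto simp: cycle_edges_def path_edges_append path_edges_Cons)
  qed (use Cons in simp)
qed simp

lemma cycle_edges_rotate: "cycle_edges (rotate n c) = cycle_edges c"
  by (induction n) (simp_all add: cycle_edges_rotate1)

lemma cycle_in_rotate: "cycle_in E (rotate n c) = cycle_in E c"
  by (simp add: cycle_in_def cycle_edges_rotate)

lemma rotate_to_hd: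
  assumes "v \<in> set c"
  obtains n where "hd (rotate n c) = v"
proof -
  obtain n where "n < length c" "c ! n = v" using assms by (auto simp: in_set_conv_nth)
  moreover have "c \<noteq> []" using assms by auto
  ultimately have "hd (rotate n c) = v" by (simp add: hd_rotate_conv_nth)
  then show thesis by (rule that)
qed

text \<open>Any edge of a cycle can play the closing edge; the rest of the cycle is then the edge
  set of one path, which the drawing turns into an arc.\<close>

lemma rotate_to_closing_edge:
  assumes "c \<noteq> []" and "e \<in> cycle_edges c"
  obtains n where "e = {last (rotate n c), hd (rotate n c)}"
proof (cases "e = {last c, hd c}")
  case True
  then show thesis using that[of 0] by simp
next
  case False
  then obtain i where i: "e = {c ! i, c ! Suc i}" "Suc i < length c"
    using assms by (auto simp: cycle_edges_def path_edges_conv_nth)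
  have "hd (rotate (Suc i) c) = c ! Suc i"
    using i assms by (metis hd_rotate_conv_nth mod_less)
  moreover have "last (rotate (Suc i) c) = c ! i"
  proof -
    have "rotate (Suc i) c = drop (Suc i) c @ take (Suc i) c"
      using i by (simp add: rotate_drop_take)
    moreover have "take (Suc i) c = take i c @ [c ! i]"
      using i by (simp add: take_Suc_conv_app_nth)
    ultimately show ?thesis by simp
  qed
  ultimately show thesis using that[of "Suc i"] i by simp
qed

text \<open>With two vertices the closing edge would retrace the path. From three on, the last
  vertex lies beyond the second, so the closing edge is not the first path edge, and no later path
  edge contains the first vertex.\<close>

lemma closing_edge_notin_path_edges:
  assumes "distinct c" "3 \<le> length c"
  shows "{last c, hd c} \<notin> path_edges c"
proof -
  obtain x y z zs where c: "c = x # y # z # zs"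
    using assms(2) by (metis (no_types, opaque_lifting) Suc_le_length_iff numeral_3_eq_3)
  have l: "last c \<in> set (z # zs)" using c by (metis last_ConsR last_in_set list.distinct(1))
  have "{last c, x} \<noteq> {x, y}" using l c assms(1) by (auto simp: doubleton_eq_iff)
  moreover have "{last c, x} \<notin> path_edges (y # z # zs)"
    using Union_path_edges_subset[of "y # z # zs"] c assms(1) by auto
  ultimately show ?thesis using c by simp
qed

text \<open>These two edges per cycle will cancel against the two faces per edge when faces are
  counted at a vertex.\<close>

lemma cycle_two_edges:
  assumes "cycle_in E c" "v \<in> set c"
  shows "2 \<le> card (inc (cycle_edges c) v)"
proof -
  obtain n where n: "hd (rotate n c) = v" using rotate_to_hd assms(2) by metis
  define c' where "c' = rotate n c"
  have c': "distinct c'" "3 \<le> length c'" "cycle_edges c' = cycle_edges c" "hd c' = v"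
    using assms(1) n by (simp_all add: c'_def cycle_in_def cycle_edges_rotate)
  then obtain y zs where c'_eq: "c' = v # y # zs"
    by (metis (no_types, opaque_lifting) Suc_le_length_iff list.sel(1) numeral_3_eq_3)
  have "{v, y} \<in> path_edges c'" using c'_eq by simp
  moreover have "{last c', v} \<notin> path_edges c'"
    using closing_edge_notin_path_edges[of c'] c' by simp
  ultimately have ne: "{v, y} \<noteq> {last c', v}" by metis
  have sub: "{{v, y}, {last c', v}} \<subseteq> inc (cycle_edges c) v"
    using \<open>{v, y} \<in> path_edges c'\<close> c'(4) unfolding c'(3)[symmetric]
    by (auto simp: inc_def cycle_edges_def)
  have "finite (path_edges c')" by (simp add: finite_path_edges)
  then have "finite (cycle_edges c)" unfolding c'(3)[symmetric] by (simp add: cycle_edges_def)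
  then have "card {{v, y}, {last c', v}} \<le> card (inc (cycle_edges c) v)"
    using sub by (intro card_mono) auto
  then show ?thesis using ne by simp
qed

text \<open>A longest path closes up to a cycle at its first vertex.\<close>

lemma cycle_exists:
  assumes fin: "finite E" and card2: "\<And>e. e \<in> E \<Longrightarrow> card e = 2" and ne: "E \<noteq> {}"
    and deg: "\<And>v. v \<in> \<Union> E \<Longrightarrow> 2 \<le> card (inc E v)"
  shows "\<exists>c. cycle_in E c"
proof -
  define P where "P xs \<longleftrightarrow> distinct xs \<and> xs \<noteq> [] \<and> set xs \<subseteq> \<Union> E \<and> path_edges xs \<subseteq> E" for xs
  have finU: "finite (\<Union> E)"
    using fin card2 by (metis card.infinite finite_Union zero_neq_numeral)
  obtain e where "e \<in> E" using ne by auto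
  then obtain v where "v \<in> e" using card2 by fastforce
  then have P0: "P [v]" using \<open>e \<in> E\<close> by (auto simp: P_def)
  have bound: "length xs \<le> card (\<Union> E)" if "P xs" for xs
    using that finU card_mono[of "\<Union> E" "set xs"] by (simp add: P_def distinct_card)
  obtain xs where xs: "P xs" and max: "\<And>ys. P ys \<Longrightarrow> length ys \<le> length xs"
    using ex_has_greatest_nat[of P "[v]" length "Suc (card (\<Union> E))"] P0 bound
    by (auto simp: less_Suc_eq_le)
  obtain x ys where xs_eq: "xs = x # ys" using xs by (cases xs) (auto simp: P_def)
  have "2 \<le> card (inc E x)" using xs xs_eq by (intro deg) (auto simp: P_def)
  \<comment> \<open>For a one-vertex path \<open>hd ys\<close> is unspecified. This is harmless: any
    edge at \<open>x\<close> other than \<open>{x, hd ys}\<close> leads, by maximality, to a vertex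
    already on the path.\<close>
  then have "\<not> inc E x \<subseteq> {{x, hd ys}}"
    using card_mono[of "{{x, hd ys}}" "inc E x"] by auto
  then obtain f where f: "f \<in> E" "x \<in> f" "f \<noteq> {x, hd ys}" by (auto simp: inc_def)
  then obtain y where y: "f = {x, y}" "y \<noteq> x"
    using card2[of f] by (metis card_2_iff doubleton_eq_iff insertE singletonD)
  have "y \<in> set xs"
  proof (rule ccontr)
    assume "y \<notin> set xs"
    then have "P (y # xs)"
      using xs y f(1) xs_eq by (auto simp: P_def insert_commute)
    then show False using max[of "y # xs"] by simp
  qed
  then have "y \<in> set ys" using y xs_eq by auto
  then obtain us vs where uv: "ys = us @ y # vs" by (meson split_list)
  have us: "us \<noteq> []" using f(3) y uv by auto
  let ?c = "x # us @ [y]"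
  have "path_edges ?c \<subseteq> path_edges xs"
    using uv us xs_eq path_edges_append[of ?c vs] by (cases "vs = []") auto
  then have "cycle_in E ?c"
    using xs us f(1) y uv xs_eq
    by (auto simp: cycle_in_def cycle_edges_def P_def insert_commute Suc_le_eq)
  then show ?thesis by blast
qed

lemma acyclic_leaf:
  assumes "finite E" "\<And>e. e \<in> E \<Longrightarrow> card e = 2" "E \<noteq> {}" "\<nexists>c. cycle_in E c"
  obtains v w where "{v, w} \<in> E" "v \<noteq> w" "inc E v = {{v, w}}"
proof -
  obtain v where v: "v \<in> \<Union> E" "card (inc E v) < 2"
    using cycle_exists[of E] assms by (meson not_le)
  then obtain e where e: "e \<in> E" "v \<in> e" by auto
  then obtain w where w: "e = {v, w}" "v \<noteq> w"
    using assms(2)[of e] by (metis card_2_iff doubleton_eq_iff insertE singletonD)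
  have "e \<in> inc E v" using e by (simp add: inc_def)
  moreover have "card (inc E v) \<noteq> 0" using calculation assms(1) by auto
  then have "card (inc E v) = 1" using v(2) by linarith
  ultimately have "inc E v = {e}" by (metis card_1_singletonE singletonD)
  then show thesis using that e w by blast
qed

lemma acyclic_card_less:
  assumes "finite E" "\<And>e. e \<in> E \<Longrightarrow> card e = 2" "finite V" "V \<noteq> {}" "\<Union> E \<subseteq> V"
    "\<nexists>c. cycle_in E c"
  shows "card E < card V"
  using assms
proof (induction "card E" arbitrary: E V)
  case 0
  then show ?case by (simp add: card_gt_0_iff)
next
  case (Suc n)
  have "E \<noteq> {}" using Suc.hyps(2) by auto
  then obtain v w where vw: "{v, w} \<in> E" "v \<noteq> w" "inc E v = {{v, w}}"
    using acyclic_leaf[OF Suc.prems(1) Suc.prems(2)] Suc.prems(6) by metis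
  let ?E = "E - {{v, w}}" and ?V = "V - {v}"
  have "card ?E < card ?V"
  proof (rule Suc.hyps(1))
    show "n = card ?E" using Suc.hyps(2) vw(1) Suc.prems(1) by simp
    show "?V \<noteq> {}" using vw Suc.prems(5) by auto
    have "v \<notin> e" if "e \<in> ?E" for e
      using that vw(3) by (auto simp: inc_def set_eq_iff)
    then show "\<Union> ?E \<subseteq> ?V" using Suc.prems(5) by blast
    show "\<nexists>c. cycle_in ?E c" using Suc.prems(6) cycle_in_mono[OF _ Diff_subset] by blast
    show "card e = 2" if "e \<in> ?E" for e using that Suc.prems(2) by blast
  qed (use Suc.prems(1,3) in simp_all)
  moreover have "v \<in> V" using vw Suc.prems(5) by auto
  ultimately show ?case
    using vw(1) Suc.prems(1,3) card.remove[of E "{v, w}"] card.remove[of V v] by linarith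
qed

section \<open>Faces of plane drawings\<close>

locale plane_graph =
  fixes G :: "'a ugraph" and p :: "'a \<Rightarrow> complex" and \<gamma> :: "'a set \<Rightarrow> real \<Rightarrow> complex"
  assumes simple: "simple_graph G" and drawing: "plane_drawing G p \<gamma>"
begin

definition picture :: "'a set set \<Rightarrow> complex set" where
  "picture E = (\<Union>e\<in>E. path_image (\<gamma> e))"

definition open_arc :: "'a set \<Rightarrow> complex set" where
  "open_arc e = path_image (\<gamma> e) - p ` e"

definition faces :: "'a set set \<Rightarrow> complex set set" where
  "faces E = components (- picture E)"

text \<open>A frontier can reach an end of an edge without running along the edge, so only interior
  points of the arc count.\<close>

definition boundary :: "'a set set \<Rightarrow> complex set \<Rightarrow> 'a set set" where
  "boundary E F = {e \<in> E. open_arc e \<inter> frontier F \<noteq> {}}"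

lemma finite_verts: "finite (verts G)"
  using simple by (simp add: simple_graph_def)

lemma edge_card: "e \<in> edges G \<Longrightarrow> card e = 2"
  using simple by (simp add: simple_graph_def)

lemma edge_subset: "e \<in> edges G \<Longrightarrow> e \<subseteq> verts G"
  using simple by (simp add: simple_graph_def)

lemma finite_edges: "finite (edges G)"
  using edge_subset finite_verts by (meson Pow_iff finite_Pow_iff finite_subset subsetI)

lemma inj_p: "u \<in> verts G \<Longrightarrow> v \<in> verts G \<Longrightarrow> p u = p v \<longleftrightarrow> u = v"
  using drawing by (auto simp: plane_drawing_def inj_on_def)

lemma edge_arc: "e \<in> edges G \<Longrightarrow> arc (\<gamma> e)"
  and edge_ends: "e \<in> edges G \<Longrightarrow> {pathstart (\<gamma> e), pathfinish (\<gamma> e)} = p ` e"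
  using drawing by (auto simp: plane_drawing_def)

lemma open_arc_vertex: "e \<in> edges G \<Longrightarrow> v \<in> verts G \<Longrightarrow> p v \<notin> open_arc e"
  using drawing unfolding plane_drawing_def open_arc_def by blast

lemma open_arc_disjoint:
  "e \<in> edges G \<Longrightarrow> f \<in> edges G \<Longrightarrow> e \<noteq> f \<Longrightarrow> open_arc e \<inter> path_image (\<gamma> f) = {}"
  using drawing by (auto simp: plane_drawing_def open_arc_def)

lemma ends_in_image: "e \<in> edges G \<Longrightarrow> p ` e \<subseteq> path_image (\<gamma> e)"
  by (metis edge_ends insert_subset empty_subsetI pathstart_in_path_image pathfinish_in_path_image)

lemma image_eq: "e \<in> edges G \<Longrightarrow> path_image (\<gamma> e) = open_arc e \<union> p ` e"
  using ends_in_image[of e] by (auto simp: open_arc_def)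

lemma connected_open_arc: "e \<in> edges G \<Longrightarrow> connected (open_arc e)"
  using connected_simple_path_endless[of "\<gamma> e"] edge_arc edge_ends
  by (simp add: open_arc_def arc_imp_simple_path)

lemma open_arc_nonempty: "e \<in> edges G \<Longrightarrow> open_arc e \<noteq> {}"
  using nonempty_simple_path_endless[of "\<gamma> e"] edge_arc edge_ends
  by (simp add: open_arc_def arc_imp_simple_path)

lemma picture_insert: "picture (insert e E) = path_image (\<gamma> e) \<union> picture E"
  by (simp add: picture_def)

lemma picture_mono: "E \<subseteq> E' \<Longrightarrow> picture E \<subseteq> picture E'"
  by (auto simp: picture_def)

lemma compact_picture: "E \<subseteq> edges G \<Longrightarrow> compact (picture E)"
  unfolding picture_def using finite_subset[OF _ finite_edges] edge_arc
  by (intro compact_UN) (auto intro: compact_arc_image)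

lemma closed_picture: "E \<subseteq> edges G \<Longrightarrow> closed (picture E)"
  by (simp add: compact_picture compact_imp_closed)

lemma vertex_on_edge:
  assumes "e \<in> edges G" "v \<in> verts G" "p v \<in> path_image (\<gamma> e)"
  shows "v \<in> e"
proof -
  have "p v \<in> p ` e" using open_arc_vertex[OF assms(1,2)] assms image_eq by blast
  then show ?thesis using inj_p edge_subset assms by blast
qed

text \<open>An interior point of an edge lies on no other edge, so a common point is a vertex, and a
  vertex on a drawn edge is an end of it. The gluing of arcs below rests on this.\<close>

lemma edge_inter_picture:
  assumes "e \<in> edges G" "E \<subseteq> edges G" "e \<notin> E"
  shows "path_image (\<gamma> e) \<inter> picture E \<subseteq> p ` (e \<inter> \<Union> E)"
proof
  fix x assume x: "x \<in> path_image (\<gamma> e) \<inter> picture E"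
  then obtain f where f: "f \<in> E" "x \<in> path_image (\<gamma> f)" by (auto simp: picture_def)
  then have "x \<notin> open_arc e" using open_arc_disjoint[of e f] assms by auto
  then obtain v where v: "v \<in> e" "x = p v" using x assms image_eq by auto
  then have "v \<in> f" using vertex_on_edge[of f v] f assms edge_subset by blast
  then show "x \<in> p ` (e \<inter> \<Union> E)" using v f by blast
qed

lemma open_arc_notin_picture:
  "e \<in> edges G \<Longrightarrow> E \<subseteq> edges G \<Longrightarrow> e \<notin> E \<Longrightarrow> open_arc e \<inter> picture E = {}"
  using edge_inter_picture[of e E] by (auto simp: open_arc_def)

section \<open>Drawn paths, Jordan curves and forests\<close>

lemma oriented_arc:
  assumes "{u, v} \<in> edges G"
  obtains g where "arc g" "path_image g = path_image (\<gamma> {u, v})" "pathstart g = p u"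
    "pathfinish g = p v"
proof -
  consider "pathstart (\<gamma> {u, v}) = p u" "pathfinish (\<gamma> {u, v}) = p v"
    | "pathstart (\<gamma> {u, v}) = p v" "pathfinish (\<gamma> {u, v}) = p u"
    using edge_ends[OF assms] by (auto simp: doubleton_eq_iff)
  then show thesis
  proof cases
    case 1 then show thesis using that edge_arc[OF assms] by blast
  next
    case 2 then show thesis
      using that[of "reversepath (\<gamma> {u, v})"] edge_arc[OF assms] by (simp add: arc_reversepath)
  qed
qed

lemma path_picture:
  assumes "distinct xs" "2 \<le> length xs" "path_edges xs \<subseteq> edges G"
  obtains g where "arc g" "path_image g = picture (path_edges xs)" "pathstart g = p (hd xs)"
    "pathfinish g = p (last xs)"
  using assms
proof (induction xs arbitrary: thesis rule: path_edges.induct)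
  case (1 x y xs)
  have xy: "{x, y} \<in> edges G" using "1.prems" by simp
  obtain g where g: "arc g" "path_image g = path_image (\<gamma> {x, y})" "pathstart g = p x"
    "pathfinish g = p y" using oriented_arc[OF xy] .
  show ?case
  proof (cases "xs = []")
    case True
    then show ?thesis using g "1.prems"(1)[of g] by (simp add: picture_def)
  next
    case False
    then obtain h where h: "arc h" "path_image h = picture (path_edges (y # xs))"
      "pathstart h = p y" "pathfinish h = p (last (y # xs))"
      using "1.IH" "1.prems" by (cases xs) auto
    have sub: "path_edges (y # xs) \<subseteq> edges G" using "1.prems" by simp
    have "x \<notin> \<Union> (path_edges (y # xs))"
      using Union_path_edges_subset[of "y # xs"] "1.prems"(2) by auto
    then have "path_image g \<inter> path_image h \<subseteq> {p y}"
      using edge_inter_picture[OF xy sub] g h by auto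
    then have "arc (g +++ h)" using g h by (intro arc_join) auto
    moreover have "path_image (g +++ h) = picture (path_edges (x # y # xs))"
      using g h by (simp add: path_image_join picture_insert)
    ultimately show ?thesis using "1.prems"(1)[of "g +++ h"] g h False by simp
  qed
qed auto

text \<open>A path and its closing arc form a simple closed curve. That the frontier of each side is
  the whole curve will bring both sides arbitrarily close to every point of every edge on the
  cycle.\<close>

lemma cycle_regions:
  assumes "cycle_in (edges G) c"
  obtains A B where "open A" "open B" "connected A" "connected B" "A \<inter> B = {}"
    "A \<union> B = - picture (cycle_edges c)"
    "frontier A = picture (cycle_edges c)" "frontier B = picture (cycle_edges c)"
proof -
  have c: "distinct c" "3 \<le> length c" "path_edges c \<subseteq> edges G" "{last c, hd c} \<in> edges G"
    using assms by (auto simp: cycle_in_def cycle_edges_def)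
  obtain g where g: "arc g" "path_image g = picture (path_edges c)" "pathstart g = p (hd c)"
    "pathfinish g = p (last c)" using path_picture[of c] c by auto
  obtain h where h: "arc h" "path_image h = path_image (\<gamma> {last c, hd c})"
    "pathstart h = p (last c)" "pathfinish h = p (hd c)" using oriented_arc[OF c(4)] .
  have "path_image g \<inter> path_image h \<subseteq> {p (hd c), p (last c)}"
    using edge_inter_picture[OF c(4,3) closing_edge_notin_path_edges[OF c(1,2)]] g h by auto
  then have "simple_path (g +++ h)" using g h by (intro simple_path_join_loop) auto
  moreover have "path_image (g +++ h) = picture (cycle_edges c)"
    using g h by (simp add: path_image_join cycle_edges_def picture_insert Un_commute)
  moreover have "pathfinish (g +++ h) = pathstart (g +++ h)" using g h by simp
  ultimately show thesis using Jordan_curve[of "g +++ h"] that by metis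
qed

text \<open>A leaf edge meets the rest of the forest in at most one point. The intersection is
  therefore connected, and Janiszewski's theorem keeps the complement connected when the edge is
  added.\<close>

lemma acyclic_complement_connected:
  assumes "E \<subseteq> edges G" "\<nexists>c. cycle_in E c"
  shows "connected (- picture E)"
  using assms
proof (induction "card E" arbitrary: E)
  case 0
  then show ?case using finite_subset[OF 0(2) finite_edges] by (simp add: picture_def connected_UNIV)
next
  case (Suc n)
  have fin: "finite E" using finite_subset[OF Suc.prems(1) finite_edges] .
  have ne: "E \<noteq> {}" using Suc.hyps(2) by auto
  obtain v w where vw: "{v, w} \<in> E" "v \<noteq> w" "inc E v = {{v, w}}"
    using acyclic_leaf[OF fin _ ne Suc.prems(2)] edge_card Suc.prems(1) by blast
  define E' where "E' = E - {{v, w}}"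
  have E': "E = insert {v, w} E'" "E' \<subseteq> edges G" "{v, w} \<in> edges G"
    using vw Suc.prems by (auto simp: E'_def)
  have "v \<notin> \<Union> E'" using vw(3) by (auto simp: E'_def inc_def set_eq_iff)
  then have "path_image (\<gamma> {v, w}) \<inter> picture E' \<subseteq> {p w}"
    using edge_inter_picture[OF E'(3,2)] by (auto simp: E'_def)
  then have "connected (path_image (\<gamma> {v, w}) \<inter> picture E')"
    by (metis connected_empty connected_sing subset_singletonD)
  moreover have "connected (- picture E')"
  proof (rule Suc.hyps(1))
    show "n = card E'" using Suc.hyps(2) vw(1) fin by (simp add: E'_def)
    show "\<nexists>c. cycle_in E' c" using Suc.prems(2) cycle_in_mono E'(1) by blast
  qed (rule E')
  moreover have "connected (- path_image (\<gamma> {v, w}))"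
    using path_connected_arc_complement[OF edge_arc[OF E'(3)]]
    by (simp add: path_connected_imp_connected)
  ultimately have "connected (- (path_image (\<gamma> {v, w}) \<union> picture E'))"
    using E' by (intro Janiszewski_connected) (auto simp: compact_arc_image edge_arc closed_picture)
  then show ?case using E'(1) by (simp add: picture_insert)
qed

section \<open>Faces and their boundaries\<close>

lemma open_face: "E \<subseteq> edges G \<Longrightarrow> F \<in> faces E \<Longrightarrow> open F"
  unfolding faces_def using open_components closed_picture open_Compl by blast

lemma face_frontier: "E \<subseteq> edges G \<Longrightarrow> F \<in> faces E \<Longrightarrow> frontier F \<subseteq> picture E"
  unfolding faces_def using frontier_of_components_closed_complement closed_picture by blast

lemma face_subset: "F \<in> faces E \<Longrightarrow> F \<subseteq> - picture E"
  unfolding faces_def by (rule in_components_subset)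

lemma face_nonempty: "F \<in> faces E \<Longrightarrow> F \<noteq> {}"
  unfolding faces_def by (rule in_components_nonempty)

lemma face_connected: "F \<in> faces E \<Longrightarrow> connected F"
  unfolding faces_def by (rule in_components_connected)

lemma faces_disjoint: "F \<in> faces E \<Longrightarrow> F' \<in> faces E \<Longrightarrow> F \<noteq> F' \<Longrightarrow> F \<inter> F' = {}"
  unfolding faces_def using components_nonoverlap by blast

lemma face_exists: "x \<notin> picture E \<Longrightarrow> \<exists>F\<in>faces E. x \<in> F"
  unfolding faces_def using Union_components[of "- picture E"] by blast

lemma face_maximal:
  "F \<in> faces E \<Longrightarrow> connected S \<Longrightarrow> S \<subseteq> - picture E \<Longrightarrow> S \<inter> F \<noteq> {} \<Longrightarrow> S \<subseteq> F"
  unfolding faces_def using components_maximal by blast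

text \<open>A forest cannot separate \<open>F\<close> from another face. Were the boundary acyclic,
  the plane without it and without the vertices would be connected, free of frontier points of
  \<open>F\<close>, and hence contained in \<open>F\<close>, although it meets every face.\<close>

lemma boundary_has_cycle:
  assumes E: "E \<subseteq> edges G" and F: "F \<in> faces E" and F': "F' \<in> faces E" "F' \<noteq> F"
  shows "\<exists>c. cycle_in (boundary E F) c"
proof (rule ccontr)
  assume acyclic: "\<nexists>c. cycle_in (boundary E F) c"
  have sub: "boundary E F \<subseteq> E" by (auto simp: boundary_def)
  \<comment> \<open>A frontier point of \<open>F\<close> on an open arc lies on a boundary edge, but
    one at a vertex is not known to be covered that way, so the finitely many vertices are removed
    as well.\<close>
  define S where "S = - picture (boundary E F) - p ` verts G"
  have "connected (- picture (boundary E F))"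
    using acyclic sub E by (intro acyclic_complement_connected) auto
  then have conn: "connected S"
    unfolding S_def using sub E finite_verts
    by (intro connected_open_delete_finite) (auto intro: closed_picture)
  have meets: "S \<inter> H \<noteq> {}" if "H \<in> faces E" for H
  proof -
    have "infinite H"
      using open_face[OF E that] face_nonempty[OF that] finite_imp_not_open by blast
    then have "\<not> H \<subseteq> p ` verts G" using finite_verts finite_subset by blast
    moreover have "H \<subseteq> - picture (boundary E F)"
      using face_subset[OF that] picture_mono[OF sub] by auto
    ultimately show ?thesis by (auto simp: S_def)
  qed
  have "S \<inter> frontier F = {}"
  proof (rule ccontr)
    assume "S \<inter> frontier F \<noteq> {}"
    then obtain x where x: "x \<in> S" "x \<in> frontier F" by auto
    then obtain e where e: "e \<in> E" "x \<in> path_image (\<gamma> e)"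
      using face_frontier[OF E F] by (auto simp: picture_def)
    moreover have "e \<in> edges G" using e E by auto
    ultimately have "x \<in> open_arc e"
      using image_eq[of e] edge_subset[of e] x(1) by (auto simp: S_def)
    then have "e \<in> boundary E F" using e x(2) by (auto simp: boundary_def)
    then show False using e x(1) by (auto simp: S_def picture_def)
  qed
  then have "S \<subseteq> F" using connected_Int_frontier[OF conn, of F] meets[OF F] by blast
  then have "F \<inter> F' \<noteq> {}" using meets[OF F'(1)] by blast
  then show False using faces_disjoint[OF F F'(1)] F'(2) by blast
qed

text \<open>Two faces on the same side of the cycle \<open>c\<close> and both touching its edge \<open>e\<close> are joined
  in the complement of \<open>c\<close> as well as in the complement of the other edges; these two closed
  sets meet in the arc \<open>c - e\<close>, so Janiszewski's theorem joins the faces.\<close>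

lemma same_side_face_unique:
  assumes E: "E \<subseteq> edges G" and c: "cycle_in E c" "e \<in> cycle_edges c"
    and F: "F1 \<in> faces E" "F2 \<in> faces E" "e \<in> boundary E F1" "e \<in> boundary E F2"
    and S: "connected S" "S \<subseteq> - picture (cycle_edges c)" "F1 \<inter> S \<noteq> {}" "F2 \<inter> S \<noteq> {}"
  shows "F1 = F2"
proof -
  have ce: "cycle_edges c \<subseteq> E" using c by (simp add: cycle_in_def)
  have eG: "e \<in> edges G" using ce c(2) E by auto
  define K where "K = E - {e}"
  have KG: "K \<subseteq> edges G" using E by (auto simp: K_def)
  obtain n where n: "e = {last (rotate n c), hd (rotate n c)}"
    using rotate_to_closing_edge[OF _ c(2)] c(1) unfolding cycle_in_def by force
  define d where "d = rotate n c"
  have d: "distinct d" "3 \<le> length d" "cycle_edges d = cycle_edges c" "e = {last d, hd d}"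
    using c(1) n by (simp_all add: d_def cycle_in_def cycle_edges_rotate)
  have e_notin: "e \<notin> path_edges d" using closing_edge_notin_path_edges d by metis
  have "path_edges d \<subseteq> cycle_edges c" unfolding d(3)[symmetric] by (auto simp: cycle_edges_def)
  then have dK: "path_edges d \<subseteq> K" using ce e_notin by (auto simp: K_def)
  obtain g where g: "arc g" "path_image g = picture (path_edges d)" "pathstart g = p (hd d)"
    "pathfinish g = p (last d)"
  proof (rule path_picture[of d])
    show "path_edges d \<subseteq> edges G" using dK KG by (rule subset_trans)
  qed (use d(1,2) in simp_all)
  have C: "picture (cycle_edges c) = path_image (\<gamma> e) \<union> path_image g"
    unfolding d(3)[symmetric] using g d(4) by (simp add: cycle_edges_def picture_insert)
  have "path_image (\<gamma> e) \<inter> picture K \<subseteq> p ` e"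
    using edge_inter_picture[OF eG KG] by (auto simp: K_def)
  moreover have "p ` e \<subseteq> path_image g"
    using d(4) g pathstart_in_path_image[of g] pathfinish_in_path_image[of g] by auto
  moreover have "path_image g \<subseteq> picture K" using g dK picture_mono by auto
  ultimately have int: "picture (cycle_edges c) \<inter> picture K = path_image g" using C by blast
  have un: "picture (cycle_edges c) \<union> picture K = picture E"
    using ce c(2) by (auto simp: picture_def K_def)
  have arcK: "open_arc e \<subseteq> - picture K"
    using open_arc_notin_picture[OF eG KG] by (auto simp: K_def)
  \<comment> \<open>Deleting \<open>e\<close> merges the faces next to it: every face whose frontier
    meets the open arc lies in the single face \<open>W\<close> of the remaining edges.\<close>
  obtain W where W: "W \<in> faces K" "open_arc e \<inter> W \<noteq> {}"
    using open_arc_nonempty[OF eG] arcK face_exists[of _ K] by blast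
  have eW: "open_arc e \<subseteq> W" using face_maximal[OF W(1) connected_open_arc[OF eG] arcK W(2)] .
  have FW: "F \<subseteq> W" if "F \<in> faces E" "e \<in> boundary E F" for F
  proof -
    have "W \<inter> closure F \<noteq> {}" using that(2) eW by (auto simp: boundary_def frontier_def)
    then have "F \<inter> W \<noteq> {}"
      using open_face[OF KG W(1)] open_Int_closure_eq_empty[of W F] by blast
    moreover have "F \<subseteq> - picture K" using face_subset[OF that(1)] un by auto
    ultimately show ?thesis using face_maximal[OF W(1) face_connected[OF that(1)]] by blast
  qed
  obtain a b where a: "a \<in> F1" "a \<in> S" and b: "b \<in> F2" "b \<in> S" using S by auto
  have "connected_component (- (picture (cycle_edges c) \<union> picture K)) a b"
  proof (rule Janiszewski)
    show "compact (picture (cycle_edges c))" using compact_picture ce E by auto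
    show "closed (picture K)" using closed_picture KG .
    show "connected (picture (cycle_edges c) \<inter> picture K)"
      unfolding int using g(1) by (simp add: connected_arc_image)
    show "connected_component (- picture (cycle_edges c)) a b"
      unfolding connected_component_def using S a b by blast
    show "connected_component (- picture K) a b"
      unfolding connected_component_def
      using face_connected[OF W(1)] face_subset[OF W(1)] FW F a b by blast
  qed
  then obtain T where T: "connected T" "T \<subseteq> - picture E" "a \<in> T" "b \<in> T"
    unfolding un connected_component_def by blast
  then have "T \<subseteq> F1" using face_maximal[OF F(1)] a by blast
  then show ?thesis using faces_disjoint[OF F(1,2)] T b by blast
qed

text \<open>A cycle through \<open>e\<close> has two sides, and each contributes at most one face
  touching \<open>e\<close>. A finite family is used because \<open>card\<close> of an infinite set
  is 0 and would say nothing.\<close>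

lemma at_most_two_faces:
  assumes E: "E \<subseteq> edges G" and c: "cycle_in E c" "e \<in> cycle_edges c"
    and \<F>: "finite \<F>" "\<F> \<subseteq> {F \<in> faces E. e \<in> boundary E F}"
  shows "card \<F> \<le> 2"
proof -
  obtain A B where AB: "connected A" "connected B" "A \<union> B = - picture (cycle_edges c)"
    using cycle_regions cycle_in_mono[OF c(1) E] by metis
  have ce: "cycle_edges c \<subseteq> E" using c by (simp add: cycle_in_def)
  have single: "card {F \<in> \<F>. F \<inter> S \<noteq> {}} \<le> 1"
    if "connected S" "S \<subseteq> - picture (cycle_edges c)" for S
  proof -
    have "F1 = F2" if "F1 \<in> {F \<in> \<F>. F \<inter> S \<noteq> {}}" "F2 \<in> {F \<in> \<F>. F \<inter> S \<noteq> {}}" for F1 F2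
      using that \<F> \<open>connected S\<close> \<open>S \<subseteq> _\<close> by (intro same_side_face_unique[OF E c, of _ _ S]) auto
    then show ?thesis using \<F>(1) by (simp add: card_le_Suc0_iff_eq)
  qed
  have "F \<inter> A \<noteq> {} \<or> F \<inter> B \<noteq> {}" if "F \<in> \<F>" for F
  proof -
    have "F \<in> faces E" using that \<F> by auto
    then have "F \<noteq> {}" "F \<subseteq> A \<union> B"
      using face_nonempty[of F E] face_subset[of F E] picture_mono[OF ce] AB(3) by auto
    then show ?thesis by auto
  qed
  then have "\<F> = {F \<in> \<F>. F \<inter> A \<noteq> {}} \<union> {F \<in> \<F>. F \<inter> B \<noteq> {}}" by auto
  then have "card \<F> = card ({F \<in> \<F>. F \<inter> A \<noteq> {}} \<union> {F \<in> \<F>. F \<inter> B \<noteq> {}})"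
    by (rule arg_cong)
  also have "\<dots> \<le> card {F \<in> \<F>. F \<inter> A \<noteq> {}} + card {F \<in> \<F>. F \<inter> B \<noteq> {}}"
    by (rule card_Un_le)
  finally show ?thesis using single[of A] single[of B] AB by force
qed

text \<open>Both sides of the cycle come arbitrarily close to a point of \<open>e\<close>, so the
  face \<open>W\<close> around that point contains a new face on either side. Every other old face
  contains some new face, and disjointness of the old faces keeps all of these distinct.\<close>

lemma face_split:
  assumes E: "insert e E \<subseteq> edges G" "e \<notin> E" and c: "cycle_in (insert e E) c" "e \<in> cycle_edges c"
    and \<F>: "finite \<F>" "\<F> \<subseteq> faces E"
  shows "\<exists>\<F>'. finite \<F>' \<and> \<F>' \<subseteq> faces (insert e E) \<and> card \<F> < card \<F>'"
proof -
  have eG: "e \<in> edges G" and EG: "E \<subseteq> edges G" using E by auto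
  have ce: "cycle_edges c \<subseteq> insert e E" using c(1) by (simp add: cycle_in_def)
  obtain A B where AB: "open A" "open B" "A \<inter> B = {}" "A \<union> B = - picture (cycle_edges c)"
    "frontier A = picture (cycle_edges c)" "frontier B = picture (cycle_edges c)"
    using cycle_regions cycle_in_mono[OF c(1) E(1)] by metis
  obtain W x where W: "W \<in> faces E" "x \<in> open_arc e" "x \<in> W"
    using open_arc_nonempty[OF eG] open_arc_notin_picture[OF eG EG E(2)] face_exists[of _ E] by blast
  have xC: "x \<in> picture (cycle_edges c)" using W(2) c(2) by (auto simp: picture_def open_arc_def)
  have side: "\<exists>H\<in>faces (insert e E). H \<subseteq> W \<and> H \<inter> S \<noteq> {}"
    if "open S" "frontier S = picture (cycle_edges c)" "S \<subseteq> - picture (cycle_edges c)" for S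
  proof -
    have "x \<in> closure S" using xC that by (auto simp: frontier_def)
    then have "W \<inter> S \<noteq> {}"
      using open_Int_closure_eq_empty[OF open_face[OF EG W(1)], of S] W(3) by blast
    then obtain z where z: "z \<in> W" "z \<in> S" by auto
    have "path_image (\<gamma> e) \<subseteq> picture (cycle_edges c)" using c(2) by (auto simp: picture_def)
    then have "z \<notin> picture (insert e E)"
      using z that(3) face_subset[OF W(1)] by (auto simp: picture_insert)
    then obtain H where H: "H \<in> faces (insert e E)" "z \<in> H" using face_exists by blast
    moreover have "H \<subseteq> W"
      using face_maximal[OF W(1) face_connected[OF H(1)]] face_subset[OF H(1)] z H(2)
      by (auto simp: picture_insert)
    ultimately show ?thesis using z by blast
  qed
  obtain H1 where H1: "H1 \<in> faces (insert e E)" "H1 \<subseteq> W" "H1 \<inter> A \<noteq> {}"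
    using side[of A] AB by blast
  obtain H2 where H2: "H2 \<in> faces (insert e E)" "H2 \<subseteq> W" "H2 \<inter> B \<noteq> {}"
    using side[of B] AB by blast
  have "H1 \<noteq> H2"
  proof
    assume eq: "H1 = H2"
    have "H1 \<subseteq> A \<union> B" using face_subset[OF H1(1)] picture_mono[OF ce] AB(4) by auto
    then show False
      using connectedD[OF face_connected[OF H1(1)] AB(1,2)] AB(3) H1(3) H2(3) eq by blast
  qed
  have "\<exists>H\<in>faces (insert e E). H \<subseteq> F" if F: "F \<in> faces E" for F
  proof -
    \<comment> \<open>A face is open and nonempty, whereas the curve has no interior, each of its
      points being a limit of points of \<open>A\<close>.\<close>
    have "\<not> F \<subseteq> path_image (\<gamma> e)"
    proof
      assume "F \<subseteq> path_image (\<gamma> e)"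
      then have FC: "F \<subseteq> picture (cycle_edges c)" using c(2) by (auto simp: picture_def)
      then have "F \<inter> closure A \<noteq> {}"
        using face_nonempty[OF F] AB(5) by (auto simp: frontier_def)
      then have "F \<inter> A \<noteq> {}" using open_Int_closure_eq_empty[OF open_face[OF EG F]] by blast
      then show False using FC AB(4) by blast
    qed
    then obtain z where z: "z \<in> F" "z \<notin> picture (insert e E)"
      using face_subset[OF F] by (auto simp: picture_insert)
    then obtain H where H: "H \<in> faces (insert e E)" "z \<in> H" using face_exists by blast
    moreover have "H \<subseteq> F"
      using face_maximal[OF F face_connected[OF H(1)]] face_subset[OF H(1)] z H(2)
      by (auto simp: picture_insert)
    ultimately show ?thesis by blast
  qed
  then obtain h where h: "\<And>F. F \<in> faces E \<Longrightarrow> h F \<in> faces (insert e E) \<and> h F \<subseteq> F" by metis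
  have apart: "h F \<inter> W = {}" if "F \<in> \<F> - {W}" for F
    using h[of F] faces_disjoint[of F E W] that \<F>(2) W(1) by blast
  have "inj_on h (\<F> - {W})"
  proof (rule inj_onI)
    fix F F' assume FF: "F \<in> \<F> - {W}" "F' \<in> \<F> - {W}" "h F = h F'"
    then have "h F \<subseteq> F \<inter> F'" "h F \<noteq> {}" using h face_nonempty \<F>(2) by blast+
    then show "F = F'" using faces_disjoint[of F E F'] FF \<F>(2) by blast
  qed
  then have "card (h ` (\<F> - {W})) = card (\<F> - {W})" by (rule card_image)
  moreover have "H1 \<notin> h ` (\<F> - {W})" "H2 \<notin> h ` (\<F> - {W})"
    using apart H1(2) H2(2) face_nonempty[OF H1(1)] face_nonempty[OF H2(1)] by blast+
  ultimately have "card (insert H1 (insert H2 (h ` (\<F> - {W})))) = card (\<F> - {W}) + 2"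
    using \<open>H1 \<noteq> H2\<close> \<F>(1) by simp
  \<comment> \<open>\<open>W\<close> may or may not belong to the given family; either way at most
    one face is traded for \<open>H1\<close> and \<open>H2\<close>.\<close>
  moreover have "card \<F> \<le> card (\<F> - {W}) + 1" by (metis \<F>(1) add.commute card.infinite card_Suc_Diff1 card_Diff_singleton_if diff_le_self le_SucI order_refl plus_1_eq_Suc)
  ultimately have "card \<F> < card (insert H1 (insert H2 (h ` (\<F> - {W}))))" by linarith
  moreover have "insert H1 (insert H2 (h ` (\<F> - {W}))) \<subseteq> faces (insert e E)"
    using H1(1) H2(1) h \<F>(2) by auto
  ultimately show ?thesis using \<F>(1) by (metis finite.insertI finite_Diff finite_imageI)
qed

text \<open>Every edge outside a maximal acyclic set closes a cycle when it is added, and then splits a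
  face by the Jordan curve theorem.\<close>

lemma many_faces:
  assumes E: "E \<subseteq> edges G" and V: "finite V" "V \<noteq> {}" "\<Union> E \<subseteq> V"
  obtains \<F> where "finite \<F>" "\<F> \<subseteq> faces E" "card E + 2 \<le> card \<F> + card V"
proof -
  have finE: "finite E" using finite_subset[OF E finite_edges] .
  define acyc where "acyc T \<longleftrightarrow> T \<subseteq> E \<and> (\<nexists>c. cycle_in T c)" for T
  have "acyc {}" by (auto simp: acyc_def cycle_in_def cycle_edges_def)
  moreover have "card T \<le> card E" if "acyc T" for T
    using that finE by (auto simp: acyc_def card_mono)
  ultimately obtain T where T: "acyc T" and Tmax: "\<And>T'. acyc T' \<Longrightarrow> card T' \<le> card T"
    using ex_has_greatest_nat[of acyc "{}" card "Suc (card E)"] by (auto simp: less_Suc_eq_le)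
  have TE: "T \<subseteq> E" using T by (simp add: acyc_def)
  have finT: "finite T" using finite_subset[OF TE finE] .
  \<comment> \<open>At most |V| - 1 edges are in \<open>T\<close>, so at least |E| - |V| + 1 edges
    are added later, each giving one face beyond the first.\<close>
  have "card T < card V"
  proof (rule acyclic_card_less[OF finT _ V(1,2)])
    show "\<Union> T \<subseteq> V" using TE V(3) by auto
    show "\<nexists>c. cycle_in T c" using T by (simp add: acyc_def)
  qed (use TE E edge_card in blast)
  have closes: "\<exists>c. cycle_in (insert e T) c \<and> e \<in> cycle_edges c" if e: "e \<in> E" "e \<notin> T" for e
  proof -
    have "\<not> acyc (insert e T)" using Tmax[of "insert e T"] e finT by auto
    then obtain c where c: "cycle_in (insert e T) c" using e TE by (auto simp: acyc_def)
    moreover have "\<not> cycle_in T c" using T by (auto simp: acyc_def)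
    ultimately show ?thesis by (auto simp: cycle_in_def)
  qed
  have grow: "\<exists>\<F>. finite \<F> \<and> \<F> \<subseteq> faces (T \<union> X) \<and> card X + 1 \<le> card \<F>" if "X \<subseteq> E - T" for X
  proof -
    have "finite X" using that finE finite_subset by blast
    then show ?thesis using that
    proof (induction X rule: finite_induct)
      case empty
      have "compact (picture T)" using TE E by (intro compact_picture) auto
      then have "picture T \<noteq> UNIV" using not_compact_UNIV by metis
      then obtain F where "F \<in> faces T" using face_exists by blast
      then show ?case by (intro exI[of _ "{F}"]) simp
    next
      case (insert e X)
      then obtain \<F> where \<F>: "finite \<F>" "\<F> \<subseteq> faces (T \<union> X)" "card X + 1 \<le> card \<F>" by auto
      obtain c where c: "cycle_in (insert e T) c" "e \<in> cycle_edges c"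
        using closes[of e] insert.prems by auto
      have "cycle_in (insert e (T \<union> X)) c" by (rule cycle_in_mono[OF c(1)]) auto
      moreover have "insert e (T \<union> X) \<subseteq> edges G" "e \<notin> T \<union> X"
        using insert TE E by auto
      ultimately obtain \<F>' where "finite \<F>'" "\<F>' \<subseteq> faces (insert e (T \<union> X))" "card \<F> < card \<F>'"
        using face_split[OF _ _ _ c(2) \<F>(1,2)] by blast
      then show ?case using \<F>(3) insert.hyps by (intro exI[of _ \<F>']) auto
    qed
  qed
  obtain \<F> where \<F>: "finite \<F>" "\<F> \<subseteq> faces (T \<union> (E - T))" "card (E - T) + 1 \<le> card \<F>"
    using grow[of "E - T"] by blast
  moreover have "T \<union> (E - T) = E" using TE by auto
  moreover have "card (E - T) + card T = card E"
    using TE finE finT by (metis card_Diff_subset card_mono le_add_diff_inverse2)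
  ultimately show thesis using that[of \<F>] \<open>card T < card V\<close> by auto
qed

end

section \<open>Consecutive vertices of degree two\<close>

lemma double_count:
  assumes "finite A" "finite B"
  shows "(\<Sum>x\<in>A. card {y \<in> B. R x y}) = (\<Sum>y\<in>B. card {x \<in> A. R x y})"
  using sum.swap_restrict[OF assms, of "\<lambda>_ _. 1::nat" R] by simp

text \<open>With a member of \<open>B\<close> rotated to the front, the next 15 positions split into
  five windows of three, each with a further member. This is where 16 = 1 + 5 * 3 enters. The
  hypothesis speaks of all rotations so that the windows may be taken after this one.\<close>

lemma six_in_cyclic_list:
  assumes c: "distinct c" "16 \<le> length c"
    and B: "\<And>n i. i + 2 < length c \<Longrightarrow> let d = rotate n c in
      d ! i \<in> B \<or> d ! (i + 1) \<in> B \<or> d ! (i + 2) \<in> B"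
  shows "6 \<le> card (set c \<inter> B)"
proof -
  have "0 < length c" "1 < length c" "2 < length c" using c(2) by linarith+
  from this[THEN nth_mem] have "\<exists>v\<in>set c. v \<in> B"
    using B[of 0 0] c(2) by (auto simp: Let_def)
  then obtain v n where v: "v \<in> B" "v \<in> set c" "hd (rotate n c) = v" using rotate_to_hd by metis
  define d where "d = rotate n c"
  have "c \<noteq> []" using c(2) by auto
  then have d: "distinct d" "set d = set c" "length d = length c" "d ! 0 \<in> B"
    using c v hd_conv_nth[of d] by (auto simp: d_def)
  have "\<exists>j. 3 * i + 1 \<le> j \<and> j \<le> 3 * i + 3 \<and> d ! j \<in> B" if "i < 5" for i
  proof -
    have "d ! (3 * i + 1) \<in> B \<or> d ! (3 * i + 2) \<in> B \<or> d ! (3 * i + 3) \<in> B"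
      using B[of "3 * i + 1" n] that c(2) by (auto simp: d_def Let_def numeral_3_eq_3)
    then consider "d ! (3 * i + 1) \<in> B" | "d ! (3 * i + 2) \<in> B" | "d ! (3 * i + 3) \<in> B" by blast
    then show ?thesis
    proof cases
      case 1 then show ?thesis by (intro exI[of _ "3 * i + 1"]) simp
    next
      case 2 then show ?thesis by (intro exI[of _ "3 * i + 2"]) simp
    next
      case 3 then show ?thesis by (intro exI[of _ "3 * i + 3"]) simp
    qed
  qed
  then obtain g where g: "\<And>i. i < 5 \<Longrightarrow> 3 * i + 1 \<le> g i \<and> g i \<le> 3 * i + 3 \<and> d ! g i \<in> B" by metis
  have "inj_on g {..<5}"
  proof (rule inj_onI)
    fix i j assume "i \<in> {..<5::nat}" "j \<in> {..<5}" "g i = g j"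
    then show "i = j" using g[of i] g[of j] by auto
  qed
  then have "card (g ` {..<5}) = 5" by (simp add: card_image)
  moreover have "0 \<notin> g ` {..<5}" using g by fastforce
  ultimately have "card (insert 0 (g ` {..<5})) = 6" by simp
  moreover have J: "insert 0 (g ` {..<5}) \<subseteq> {..<length d}" using g c(2) d(3) by fastforce
  then have "inj_on ((!) d) (insert 0 (g ` {..<5}))" 
    using d(1) by (intro inj_on_nth) auto
  ultimately have "card ((!) d ` insert 0 (g ` {..<5})) = 6" by (simp only: card_image)
  moreover have "(!) d ` insert 0 (g ` {..<5}) \<subseteq> set c \<inter> B"
    using J g d by (auto simp flip: d(2))
  ultimately show ?thesis by (metis List.finite_set card_mono finite_Int)
qed

lemma three_consecutive_branch:
  assumes c: "cycle_in E c" and i: "i + 2 < length c"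
    and none: "\<And>x y z. {x, y} \<in> E \<Longrightarrow> {y, z} \<in> E \<Longrightarrow> x \<noteq> z \<Longrightarrow> x \<in> B \<or> y \<in> B \<or> z \<in> B"
  shows "c ! i \<in> B \<or> c ! (i + 1) \<in> B \<or> c ! (i + 2) \<in> B"
proof (rule none)
  have "path_edges c \<subseteq> E" using c by (simp add: cycle_in_def cycle_edges_def)
  moreover have "{c ! i, c ! (i + 1)} \<in> path_edges c" "{c ! (i + 1), c ! (i + 2)} \<in> path_edges c"
    using i unfolding path_edges_conv_nth by force+
  ultimately show "{c ! i, c ! (i + 1)} \<in> E" "{c ! (i + 1), c ! (i + 2)} \<in> E" by auto
  show "c ! i \<noteq> c ! (i + 2)" using c i by (simp add: cycle_in_def nth_eq_iff_index_eq)
qed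

context plane_graph
begin

text \<open>Let \<open>B\<close> be the set of vertices of degree at least three. If no three consecutive vertices
  have degree two, every cycle has at least six vertices in \<open>B\<close>. A vertex lies on at most as many
  face cycles as it has edges, so \<open>6 F \<le> \<Sum>v\<in>B. deg v\<close>, against \<open>F \<ge> |E| - |V| + 2\<close>.\<close>

lemma three_consecutive_degree_two:
  assumes E: "E \<subseteq> edges G" "E \<noteq> {}" and deg: "\<And>v. v \<in> \<Union> E \<Longrightarrow> 2 \<le> card (inc E v)"
    and long: "\<And>c. cycle_in E c \<Longrightarrow> 16 \<le> length c"
  obtains x y z where "{x, y} \<in> E" "{y, z} \<in> E" "x \<noteq> z"
    "card (inc E x) = 2" "card (inc E y) = 2" "card (inc E z) = 2"
proof (rule ccontr)
  note facts = that
  assume not_thesis: "\<not> thesis"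
  define V where "V = \<Union> E"
  define B where "B = {v \<in> V. 3 \<le> card (inc E v)}"
  have finE: "finite E" using finite_subset[OF E(1) finite_edges] .
  have finV: "finite V"
    unfolding V_def using edge_subset E(1) finite_verts by (meson Sup_least finite_subset subsetD)
  have finB: "finite B" "B \<subseteq> V" using finV by (auto simp: B_def)
  have "V \<noteq> {}" using E edge_card unfolding V_def by fastforce
  have none: "x \<in> B \<or> y \<in> B \<or> z \<in> B" if "{x, y} \<in> E" "{y, z} \<in> E" "x \<noteq> z" for x y z
  proof (rule ccontr)
    assume "\<not> (x \<in> B \<or> y \<in> B \<or> z \<in> B)"
    moreover have "v \<in> V \<Longrightarrow> v \<notin> B \<Longrightarrow> card (inc E v) = 2" for v
      using deg[of v] by (auto simp: B_def V_def)
    moreover have "x \<in> V" "y \<in> V" "z \<in> V" using that by (auto simp: V_def)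
    ultimately show False using facts that not_thesis by blast
  qed
  have six: "6 \<le> card (set c \<inter> B)" if "cycle_in E c" for c
  proof (rule six_in_cyclic_list)
    fix n i assume "i + 2 < length c"
    then show "let d = rotate n c in d ! i \<in> B \<or> d ! (i + 1) \<in> B \<or> d ! (i + 2) \<in> B"
      unfolding Let_def using that by (intro three_consecutive_branch[of E]) (auto simp: cycle_in_rotate none)
  qed (use that long in \<open>auto simp: cycle_in_def\<close>)
  have "(\<Sum>v\<in>V. card (inc E v)) = (\<Sum>e\<in>E. card {v \<in> V. v \<in> e})"
    unfolding inc_def by (rule double_count[OF finV finE])
  also have "\<dots> = (\<Sum>e\<in>E. 2)"
  proof (rule sum.cong)
    fix e assume "e \<in> E"
    moreover from this have "{v \<in> V. v \<in> e} = e" by (auto simp: V_def)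
    ultimately show "card {v \<in> V. v \<in> e} = 2" using E(1) edge_card by auto
  qed simp
  finally have handshake: "(\<Sum>v\<in>V. card (inc E v)) = 2 * card E" by simp
  \<comment> \<open>Minimum degree two gives |V| \<le> |E| and hence at least two faces; a face
    needs another one beside it for its boundary to contain a cycle.\<close>
  have "2 * card V \<le> (\<Sum>v\<in>V. card (inc E v))"
    using sum_mono[of V "\<lambda>_. 2" "\<lambda>v. card (inc E v)"] deg by (simp add: V_def)
  then have VE: "card V \<le> card E" using handshake by simp
  obtain \<F> where \<F>: "finite \<F>" "\<F> \<subseteq> faces E" "card E + 2 \<le> card \<F> + card V"
    using many_faces[OF E(1) finV \<open>V \<noteq> {}\<close>] unfolding V_def by auto
  have "\<exists>c. cycle_in (boundary E F) c" if F: "F \<in> \<F>" for F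
  proof -
    have "\<not> \<F> \<subseteq> {F}" using card_mono[of "{F}" \<F>] \<F>(3) VE by auto
    then obtain F' where "F' \<in> \<F>" "F' \<noteq> F" by auto
    then show ?thesis using boundary_has_cycle[OF E(1), of F F'] F \<F>(2) by auto
  qed
  then obtain C where C: "\<And>F. F \<in> \<F> \<Longrightarrow> cycle_in (boundary E F) (C F)" by metis
  have CE: "cycle_in E (C F)" if "F \<in> \<F>" for F
    using cycle_in_mono[OF C[OF that], of E] by (auto simp: boundary_def)
  have edge_faces: "card {F \<in> \<F>. e \<in> cycle_edges (C F)} \<le> 2" for e
  proof (cases "\<exists>F0\<in>\<F>. e \<in> cycle_edges (C F0)")
    case True
    then obtain F0 where F0: "F0 \<in> \<F>" "e \<in> cycle_edges (C F0)" by auto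
    have "{F \<in> \<F>. e \<in> cycle_edges (C F)} \<subseteq> {F \<in> faces E. e \<in> boundary E F}"
      using \<F>(2) C by (auto simp: cycle_in_def)
    then show ?thesis using at_most_two_faces[OF E(1) CE F0(2)] F0(1) \<F>(1) by simp
  next
    case False
    then have "{F \<in> \<F>. e \<in> cycle_edges (C F)} = {}" by auto
    then show ?thesis by (metis card.empty le0)
  qed
  \<comment> \<open>Each chosen cycle through \<open>v\<close> uses two edges at \<open>v\<close>,
    and each edge lies on at most two of the chosen cycles, so the two factors cancel.\<close>
  have vertex_faces: "card {F \<in> \<F>. v \<in> set (C F)} \<le> card (inc E v)" for v
  proof -
    have "2 * card {F \<in> \<F>. v \<in> set (C F)}
        = (\<Sum>F\<in>{F \<in> \<F>. v \<in> set (C F)}. 2)" by simp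
    also have "\<dots> \<le> (\<Sum>F\<in>{F \<in> \<F>. v \<in> set (C F)}. card (inc (cycle_edges (C F)) v))"
      using cycle_two_edges[OF CE] by (intro sum_mono) blast
    also have "\<dots> \<le> (\<Sum>F\<in>\<F>. card (inc (cycle_edges (C F)) v))"
      using \<F>(1) by (intro sum_mono2) auto
    also have "\<dots> = (\<Sum>F\<in>\<F>. card {e \<in> inc E v. e \<in> cycle_edges (C F)})"
    proof (rule sum.cong)
      fix F assume "F \<in> \<F>"
      then have "inc (cycle_edges (C F)) v = {e \<in> inc E v. e \<in> cycle_edges (C F)}"
        using CE[of F] unfolding inc_def cycle_in_def by blast
      then show "card (inc (cycle_edges (C F)) v) = card {e \<in> inc E v. e \<in> cycle_edges (C F)}"
        by (rule arg_cong)
    qed simp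
    also have "\<dots> = (\<Sum>e\<in>inc E v. card {F \<in> \<F>. e \<in> cycle_edges (C F)})"
      using \<F>(1) finE by (intro double_count) auto
    also have "\<dots> \<le> (\<Sum>e\<in>inc E v. 2)" by (intro sum_mono edge_faces)
    finally show ?thesis by simp
  qed
  have "6 * card \<F> = (\<Sum>F\<in>\<F>. 6)" by simp
  also have "\<dots> \<le> (\<Sum>F\<in>\<F>. card {v \<in> B. v \<in> set (C F)})"
  proof (rule sum_mono)
    fix F assume "F \<in> \<F>"
    then show "6 \<le> card {v \<in> B. v \<in> set (C F)}"
      using six[OF CE, of F] by (simp add: Int_def conj_commute)
  qed
  also have "\<dots> = (\<Sum>v\<in>B. card {F \<in> \<F>. v \<in> set (C F)})"
    by (rule double_count[OF \<F>(1) finB(1)])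
  also have "\<dots> \<le> (\<Sum>v\<in>B. card (inc E v))" by (intro sum_mono vertex_faces)
  finally have upper: "6 * card \<F> \<le> (\<Sum>v\<in>B. card (inc E v))" .
  have "(\<Sum>v\<in>V. card (inc E v)) = (\<Sum>v\<in>V - B. card (inc E v)) + (\<Sum>v\<in>B. card (inc E v))"
    using finB(2) finV by (rule sum.subset_diff)
  moreover have "(\<Sum>v\<in>V - B. card (inc E v)) = (\<Sum>v\<in>V - B. 2)"
  proof (rule sum.cong)
    fix v assume "v \<in> V - B"
    then show "card (inc E v) = 2" using deg[of v] by (auto simp: B_def V_def)
  qed simp
  moreover have "card (V - B) + card B = card V"
    using finB finV by (metis card_Diff_subset card_mono le_add_diff_inverse2)
  moreover have "3 * card B \<le> (\<Sum>v\<in>B. card (inc E v))"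
    using sum_mono[of B "\<lambda>_. 3" "\<lambda>v. card (inc E v)"] by (simp add: B_def)
  ultimately show False using upper handshake \<F>(3) by simp
qed

end

section \<open>A Nullstellensatz for products of affine forms\<close>

text \<open>The weight of the node \<open>a\<close> in the classical divided difference over
  \<open>B\<close>, that is, the leading coefficient of the Lagrange basis polynomial for
  \<open>a\<close>.\<close>

definition node_weight :: "real set \<Rightarrow> real \<Rightarrow> real" where
  "node_weight B a = (\<Prod>b\<in>B - {a}. 1 / (a - b))"

text \<open>The divided difference in several variables. On a polynomial of total degree at most
  \<Sum> (|B i| - 1) it reads off the coefficient of the monomial with exponents |B i| - 1. A
  nonzero value thus yields a grid point where the function does not vanish.\<close>

definition divided_diff :: "'i set \<Rightarrow> ('i \<Rightarrow> real set) \<Rightarrow> (('i \<Rightarrow> real) \<Rightarrow> real) \<Rightarrow> real" where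
  "divided_diff I B f = (\<Sum>y\<in>PiE I B. (\<Prod>i\<in>I. node_weight (B i) (y i)) * f y)"

definition affine_form :: "'i set \<Rightarrow> ('i \<Rightarrow> real) \<times> real \<Rightarrow> ('i \<Rightarrow> real) \<Rightarrow> real" where
  "affine_form I L y = snd L + (\<Sum>i\<in>I. fst L i * y i)"

text \<open>Keeping a polynomial as the list of its affine factors replaces polynomial arithmetic by
  induction over that list.\<close>

definition affine_prod :: "'i set \<Rightarrow> (('i \<Rightarrow> real) \<times> real) list \<Rightarrow> ('i \<Rightarrow> real) \<Rightarrow> real" where
  "affine_prod I Ls y = prod_list (map (\<lambda>L. affine_form I L y) Ls)"

lemma node_weight_remove:
  assumes "finite B" "m \<in> B" "a \<in> B" "a \<noteq> m"
  shows "node_weight B a * (a - m) = node_weight (B - {m}) a"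
proof -
  have "B - {a} = insert m (B - {m} - {a})" using assms by auto
  then have "node_weight B a = 1 / (a - m) * node_weight (B - {m}) a"
    using assms by (simp add: node_weight_def)
  then show ?thesis using assms by simp
qed

text \<open>The factor \<open>y j - m\<close> kills the node \<open>m\<close> of coordinate \<open>j\<close> and turns the remaining
  weights into those of the smaller grid.\<close>

lemma divided_diff_linear_factor:
  assumes I: "finite I" "j \<in> I" and B: "\<And>i. i \<in> I \<Longrightarrow> finite (B i)" and m: "m \<in> B j"
  shows "divided_diff I B (\<lambda>y. (y j - m) * f y) = divided_diff I (B(j := B j - {m})) f"
proof -
  let ?B = "B(j := B j - {m})"
  let ?w = "\<lambda>B y. \<Prod>i\<in>I. node_weight (B i) (y i)"
  have sub: "PiE I ?B \<subseteq> PiE I B" by (intro PiE_mono) (auto split: if_splits)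
  have fin: "finite (PiE I B)" using I B by (intro finite_PiE) auto
  have "divided_diff I B (\<lambda>y. (y j - m) * f y) = (\<Sum>y\<in>PiE I ?B. ?w B y * ((y j - m) * f y))"
    unfolding divided_diff_def
  proof (rule sum.mono_neutral_right[OF fin sub], intro ballI)
    fix y assume y: "y \<in> PiE I B - PiE I ?B"
    have "y j = m"
    proof (rule ccontr)
      assume "y j \<noteq> m"
      then have "y \<in> PiE I ?B" using y by (auto simp: PiE_iff)
      then show False using y by simp
    qed
    then show "?w B y * ((y j - m) * f y) = 0" by simp
  qed
  also have "\<dots> = (\<Sum>y\<in>PiE I ?B. ?w ?B y * f y)"
  proof (rule sum.cong)
    fix y assume y: "y \<in> PiE I ?B"
    have yj: "y j \<in> B j" "y j \<noteq> m" using y I(2) by (auto simp: PiE_iff dest!: bspec[of _ _ j])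
    have "?w B y * (y j - m) = (node_weight (B j) (y j) * (y j - m)) * (\<Prod>i\<in>I - {j}. node_weight (B i) (y i))"
      using I by (simp add: prod.remove[of I j])
    also have "\<dots> = node_weight (?B j) (y j) * (\<Prod>i\<in>I - {j}. node_weight (?B i) (y i))"
      using node_weight_remove[OF B[OF I(2)] m yj] by simp
    also have "\<dots> = ?w ?B y" using I by (simp add: prod.remove[of I j])
    finally show "?w B y * ((y j - m) * f y) = ?w ?B y * f y" by (simp add: mult.assoc[symmetric])
  qed simp
  finally show ?thesis by (simp add: divided_diff_def)
qed

lemma divided_diff_add: "divided_diff I B (\<lambda>y. f y + g y) = divided_diff I B f + divided_diff I B g"
  by (simp add: divided_diff_def ring_distribs sum.distrib)

lemma divided_diff_scale: "divided_diff I B (\<lambda>y. c * f y) = c * divided_diff I B f"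
  by (simp add: divided_diff_def sum_distrib_left mult.left_commute)

lemma divided_diff_sum: "divided_diff I B (\<lambda>y. \<Sum>i\<in>J. g i y) = (\<Sum>i\<in>J. divided_diff I B (g i))"
  unfolding divided_diff_def by (simp add: sum_distrib_left sum.swap[of _ J])

text \<open>Around a grid point \<open>m\<close> the form is its value at \<open>m\<close> plus
  multiples of the factors \<open>y i - m i\<close>, each of which removes one node. This recursion
  drives the inductions over lists of forms.\<close>

lemma divided_diff_affine:
  assumes "finite I" "\<And>i. i \<in> I \<Longrightarrow> finite (B i)" "\<And>i. i \<in> I \<Longrightarrow> m i \<in> B i"
  shows "divided_diff I B (\<lambda>y. affine_form I L y * f y) = affine_form I L m * divided_diff I B f
    + (\<Sum>i\<in>I. fst L i * divided_diff I (B(i := B i - {m i})) f)"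
proof -
  have "affine_form I L y * f y = affine_form I L m * f y + (\<Sum>i\<in>I. fst L i * ((y i - m i) * f y))" for y
    by (simp add: affine_form_def algebra_simps sum_distrib_left sum_distrib_right sum.distrib sum_subtractf)
  then have "divided_diff I B (\<lambda>y. affine_form I L y * f y) = affine_form I L m * divided_diff I B f
      + (\<Sum>i\<in>I. fst L i * divided_diff I B (\<lambda>y. (y i - m i) * f y))"
    by (simp add: divided_diff_add divided_diff_scale divided_diff_sum)
  also have "(\<Sum>i\<in>I. fst L i * divided_diff I B (\<lambda>y. (y i - m i) * f y))
      = (\<Sum>i\<in>I. fst L i * divided_diff I (B(i := B i - {m i})) f)"
    using assms by (intro sum.cong) (simp_all add: divided_diff_linear_factor)
  finally show ?thesis .
qed

text \<open>The factors \<open>a - m\<close> and \<open>a - n\<close> remove different nodes but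
  leave equal sums by induction. The difference of the two sums is \<open>n - m\<close> times the
  sum sought, which therefore vanishes.\<close>

lemma sum_node_weight:
  assumes "finite B" "B \<noteq> {}"
  shows "(\<Sum>a\<in>B. node_weight B a) = (if card B = 1 then 1 else 0)"
  using assms
proof (induction "card B" arbitrary: B rule: less_induct)
  case less
  show ?case
  proof (cases "card B = 1")
    case True
    then obtain b where "B = {b}" by (auto simp: card_1_singleton_iff)
    then show ?thesis by (simp add: node_weight_def)
  next
    case False
    then obtain m n where mn: "m \<in> B" "n \<in> B" "m \<noteq> n"
      using less.prems by (metis card_1_singleton_iff is_singletonI' is_singleton_altdef)
    have step: "(\<Sum>a\<in>B. node_weight B a * (a - k)) = (\<Sum>a\<in>B - {k}. node_weight (B - {k}) a)"
      if "k \<in> B" for k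
      using that less.prems(1) by (simp add: sum.remove[of B k] node_weight_remove)
    have IH: "(\<Sum>a\<in>B - {k}. node_weight (B - {k}) a) = (if card B = 2 then 1 else 0)"
      if "k \<in> B" for k
    proof -
      have "card (B - {k}) < card B" using that less.prems by (intro psubset_card_mono) auto
      moreover have "B - {k} \<noteq> {}" using mn by auto
      moreover have "card (B - {k}) = 1 \<longleftrightarrow> card B = 2"
        using that less.prems by (auto simp: card_Diff_singleton_if card_gt_0_iff)
      ultimately show ?thesis using less.hyps[of "B - {k}"] less.prems by simp
    qed
    have "(n - m) * (\<Sum>a\<in>B. node_weight B a)
        = (\<Sum>a\<in>B. node_weight B a * (a - m)) - (\<Sum>a\<in>B. node_weight B a * (a - n))"
      by (simp add: sum_distrib_left algebra_simps flip: sum_subtractf)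
    also have "\<dots> = 0" using step IH mn by simp
    finally show ?thesis using mn False by simp
  qed
qed

lemma divided_diff_one:
  assumes "finite I" "\<And>i. i \<in> I \<Longrightarrow> finite (B i)" "\<And>i. i \<in> I \<Longrightarrow> B i \<noteq> {}"
  shows "divided_diff I B (\<lambda>_. 1) = (if \<forall>i\<in>I. card (B i) = 1 then 1 else 0)"
proof -
  have "divided_diff I B (\<lambda>_. 1) = (\<Prod>i\<in>I. \<Sum>a\<in>B i. node_weight (B i) a)"
    unfolding divided_diff_def using assms by (simp add: prod_sum_PiE)
  also have "\<dots> = (\<Prod>i\<in>I. if card (B i) = 1 then 1 else 0)"
    using assms by (intro prod.cong) (simp_all add: sum_node_weight)
  finally show ?thesis using assms(1) by auto
qed

lemma divided_diff_empty: "i \<in> I \<Longrightarrow> B i = {} \<Longrightarrow> divided_diff I B f = 0"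
  by (simp add: divided_diff_def PiE_eq_empty_iff)

lemma affine_prod_Cons: "affine_prod I (L # Ls) = (\<lambda>y. affine_form I L y * affine_prod I Ls y)"
  by (auto simp: affine_prod_def)

text \<open>Only an inequality, because for a single node the truncated subtraction gives 0 both
  before and after the removal.\<close>

lemma sum_card_remove:
  assumes "finite I" "i \<in> I" "finite (B i)" "m \<in> B i"
  shows "(\<Sum>j\<in>I. card (B j) - 1) \<le> Suc (\<Sum>j\<in>I. card ((B(i := B i - {m})) j) - 1)"
proof -
  have "(\<Sum>j\<in>I - {i}. card ((B(i := B i - {m})) j) - 1) = (\<Sum>j\<in>I - {i}. card (B j) - 1)"
    by (intro sum.cong) auto
  then show ?thesis using assms by (simp add: sum.remove[of I i])
qed

text \<open>A factor removes at most one node. When the few factors are used up, either some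
  coordinate has become empty or one still has two nodes, and then the constant 1 is
  annihilated.\<close>

lemma divided_diff_low_degree:
  assumes "finite I" "\<And>i. i \<in> I \<Longrightarrow> finite (B i)" "length Ls < (\<Sum>i\<in>I. card (B i) - 1)"
  shows "divided_diff I B (affine_prod I Ls) = 0"
  using assms(2,3)
proof (induction Ls arbitrary: B)
  case Nil
  show ?case
  proof (cases "\<exists>i\<in>I. B i = {}")
    case False
    have "\<not> (\<forall>i\<in>I. card (B i) = 1)" using Nil(2) by fastforce
    moreover have "affine_prod I [] = (\<lambda>_. 1)" by (auto simp: affine_prod_def)
    ultimately show ?thesis using divided_diff_one[OF assms(1), of B] Nil(1) False by auto
  qed (auto intro: divided_diff_empty)
next
  case (Cons L Ls)
  show ?case
  proof (cases "\<exists>i\<in>I. B i = {}")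
    case False
    then have "\<forall>i\<in>I. \<exists>b. b \<in> B i" by blast
    then obtain m where m: "\<And>i. i \<in> I \<Longrightarrow> m i \<in> B i" by metis
    have "divided_diff I (B(i := B i - {m i})) (affine_prod I Ls) = 0" if "i \<in> I" for i
    proof (rule Cons.IH)
      show "length Ls < (\<Sum>j\<in>I. card ((B(i := B i - {m i})) j) - 1)"
        using sum_card_remove[of I i B "m i"] that assms(1) m Cons.prems by fastforce
    qed (use Cons.prems in auto)
    moreover have "divided_diff I B (affine_prod I Ls) = 0" using Cons by simp
    ultimately show ?thesis
      using divided_diff_affine[OF assms(1) Cons.prems(1) m] by (simp add: affine_prod_Cons)
  qed (auto intro: divided_diff_empty)
qed

text \<open>The only term of unknown sign is the one with the value of the form at \<open>m\<close>,
  and it vanishes because the remaining product has too low a degree. What is left has nonnegative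
  coefficients.\<close>

lemma divided_diff_nonneg:
  assumes "finite I" "\<And>i. i \<in> I \<Longrightarrow> finite (B i)" "length Ls = (\<Sum>i\<in>I. card (B i) - 1)"
    "\<And>L i. L \<in> set Ls \<Longrightarrow> i \<in> I \<Longrightarrow> 0 \<le> fst L i"
  shows "0 \<le> divided_diff I B (affine_prod I Ls)"
  using assms(2,3,4)
proof (induction Ls arbitrary: B)
  case Nil
  show ?case
  proof (cases "\<exists>i\<in>I. B i = {}")
    case False
    have "affine_prod I [] = (\<lambda>_. 1)" by (auto simp: affine_prod_def)
    then show ?thesis using divided_diff_one[OF assms(1), of B] Nil(1) False by auto
  qed (auto simp: divided_diff_empty)
next
  case (Cons L Ls)
  show ?case
  proof (cases "\<exists>i\<in>I. B i = {}")
    case False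
    then have "\<forall>i\<in>I. \<exists>b. b \<in> B i" by blast
    then obtain m where m: "\<And>i. i \<in> I \<Longrightarrow> m i \<in> B i" by metis
    have "0 \<le> divided_diff I (B(i := B i - {m i})) (affine_prod I Ls)" if i: "i \<in> I" for i
    proof -
      have "length Ls \<le> (\<Sum>j\<in>I. card ((B(i := B i - {m i})) j) - 1)"
        using sum_card_remove[of I i B "m i"] i assms(1) m Cons.prems by fastforce
      then consider "length Ls < (\<Sum>j\<in>I. card ((B(i := B i - {m i})) j) - 1)"
        | "length Ls = (\<Sum>j\<in>I. card ((B(i := B i - {m i})) j) - 1)" by linarith
      then show ?thesis
      proof cases
        case 1
        have "divided_diff I (B(i := B i - {m i})) (affine_prod I Ls) = 0"
          using Cons.prems(1) by (intro divided_diff_low_degree[OF assms(1) _ 1]) auto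
        then show ?thesis by (simp only: order_refl)
      next
        case 2
        then show ?thesis using Cons.prems by (intro Cons.IH) auto
      qed
    qed
    moreover have "divided_diff I B (affine_prod I Ls) = 0"
      using Cons.prems by (intro divided_diff_low_degree[OF assms(1)]) auto
    ultimately show ?thesis
      using divided_diff_affine[OF assms(1) Cons.prems(1) m] Cons.prems(3)
      by (simp add: affine_prod_Cons sum_nonneg)
  qed (auto simp: divided_diff_empty)
qed

text \<open>\<open>ys\<close> picks from each form a variable with positive coefficient, that is,
  one positive term of the expanded product. As no term is negative, nothing cancels it.\<close>

lemma divided_diff_pos:
  assumes "finite I" "\<And>i. i \<in> I \<Longrightarrow> finite (B i)"
    "\<And>L i. L \<in> set Ls \<Longrightarrow> i \<in> I \<Longrightarrow> 0 \<le> fst L i"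
    "list_all2 (\<lambda>L i. 0 < fst L i) Ls ys" "set ys \<subseteq> I"
    "\<And>i. i \<in> I \<Longrightarrow> card (B i) = Suc (count_list ys i)"
  shows "0 < divided_diff I B (affine_prod I Ls)"
  using assms(4,2,3,5,6)
proof (induction arbitrary: B rule: list_all2_induct)
  case Nil
  have "affine_prod I [] = (\<lambda>_. 1)" by (auto simp: affine_prod_def)
  moreover have "B i \<noteq> {}" if "i \<in> I" for i using Nil(4)[OF that] by auto
  ultimately show ?case using divided_diff_one[OF assms(1), of B] Nil by auto
next
  case (Cons L Ls k ys)
  have "\<exists>b. b \<in> B i" if "i \<in> I" for i 
    using Cons.prems(4)[OF that] card.empty by (metis ex_in_conv nat.distinct(1))
  then obtain m where m: "\<And>i. i \<in> I \<Longrightarrow> m i \<in> B i" by metis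
  have k: "k \<in> I" using Cons.prems by simp
  have len: "length Ls = length ys" using Cons.hyps(2) by (rule list_all2_lengthD)
  have tot: "(\<Sum>i\<in>I. card (B i) - 1) = Suc (length ys)"
  proof -
    have "(\<Sum>i\<in>I. card (B i) - 1) = (\<Sum>i\<in>I. count_list (k # ys) i)"
      using Cons.prems(4) by (intro sum.cong) auto
    also have "\<dots> = Suc (length ys)" using sum_count_set[OF Cons.prems(3) assms(1)] by simp
    finally show ?thesis .
  qed
  have nonneg: "0 \<le> divided_diff I (B(i := B i - {m i})) (affine_prod I Ls)" if i: "i \<in> I" for i
  proof -
    have "length Ls \<le> (\<Sum>j\<in>I. card ((B(i := B i - {m i})) j) - 1)"
      using sum_card_remove[of I i B "m i"] i assms(1) m Cons.prems(1) tot len by fastforce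
    then consider "length Ls < (\<Sum>j\<in>I. card ((B(i := B i - {m i})) j) - 1)"
      | "length Ls = (\<Sum>j\<in>I. card ((B(i := B i - {m i})) j) - 1)" by linarith
    then show ?thesis
    proof cases
      case 1
      have "divided_diff I (B(i := B i - {m i})) (affine_prod I Ls) = 0"
        using Cons.prems(1) by (intro divided_diff_low_degree[OF assms(1) _ 1]) auto
      then show ?thesis by (simp only: order_refl)
    next
      case 2
      then show ?thesis using Cons.prems by (intro divided_diff_nonneg assms(1)) auto
    qed
  qed
  have "0 < divided_diff I (B(k := B k - {m k})) (affine_prod I Ls)"
  proof (rule Cons.IH)
    show "card ((B(k := B k - {m k})) i) = Suc (count_list ys i)" if "i \<in> I" for i
      using Cons.prems(1,4)[OF that] m[OF that] by auto
  qed (use Cons.prems in auto)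
  then have "0 < fst L k * divided_diff I (B(k := B k - {m k})) (affine_prod I Ls)"
    using Cons.hyps(1) by simp
  also have "\<dots> \<le> (\<Sum>i\<in>I. fst L i * divided_diff I (B(i := B i - {m i})) (affine_prod I Ls))"
    using nonneg Cons.prems(2) assms(1) k
    by (intro member_le_sum[of k I "\<lambda>i. fst L i * divided_diff I (B(i := B i - {m i})) (affine_prod I Ls)"]) auto
  finally have "0 < (\<Sum>i\<in>I. fst L i * divided_diff I (B(i := B i - {m i})) (affine_prod I Ls))" .
  moreover have "divided_diff I B (affine_prod I Ls) = 0"
    using Cons.prems(1) tot len by (intro divided_diff_low_degree[OF assms(1)]) auto
  ultimately show ?case
    using divided_diff_affine[OF assms(1) Cons.prems(1) m] by (simp add: affine_prod_Cons)
qed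

text \<open>An instance of the Combinatorial Nullstellensatz: the coefficient of the monomial
  \<open>\<Prod>i. y i ^ count_list ys i\<close> in the product of the forms is positive.\<close>

lemma affine_forms_nonvanishing:
  assumes "finite I" "\<And>i. i \<in> I \<Longrightarrow> finite (B i)"
    "\<And>L i. L \<in> set Ls \<Longrightarrow> i \<in> I \<Longrightarrow> 0 \<le> fst L i"
    "list_all2 (\<lambda>L i. 0 < fst L i) Ls ys" "set ys \<subseteq> I"
    "\<And>i. i \<in> I \<Longrightarrow> Suc (count_list ys i) \<le> card (B i)"
  shows "\<exists>y. (\<forall>i\<in>I. y i \<in> B i) \<and> (\<forall>L\<in>set Ls. affine_form I L y \<noteq> 0)"
proof -
  \<comment> \<open>The grid is shrunk to the exact size that makes the divided difference extract
    the monomial given by \<open>ys\<close>.\<close>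
  have "\<exists>B'. B' \<subseteq> B i \<and> card B' = Suc (count_list ys i)" if "i \<in> I" for i
    using obtain_subset_with_card_n[OF assms(6)[OF that]] by metis
  then obtain B' where B': "\<And>i. i \<in> I \<Longrightarrow> B' i \<subseteq> B i \<and> card (B' i) = Suc (count_list ys i)" by metis
  have "0 < divided_diff I B' (affine_prod I Ls)"
  proof (rule divided_diff_pos[OF assms(1) _ _ assms(4,5)])
    show "finite (B' i)" "card (B' i) = Suc (count_list ys i)" if "i \<in> I" for i
      using B'[OF that] assms(2)[OF that] finite_subset by blast+
    show "0 \<le> fst L i" if "L \<in> set Ls" "i \<in> I" for L i using assms(3) that .
  qed
  then have "\<exists>y\<in>PiE I B'. affine_prod I Ls y \<noteq> 0"
    unfolding divided_diff_def by (metis (mono_tags, lifting) less_irrefl mult_zero_right sum.neutral)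
  then obtain y where y: "y \<in> PiE I B'" "affine_prod I Ls y \<noteq> 0" by blast
  moreover have "affine_form I L y \<noteq> 0" if "L \<in> set Ls" for L
    using y(2) that by (auto simp: affine_prod_def prod_list_zero_iff)
  moreover have "y i \<in> B i" if "i \<in> I" for i using PiE_mem[OF y(1) that] B'[OF that] by blast
  ultimately show ?thesis by blast
qed

section \<open>Choosing labels\<close>

lemma count_list_distinct: "distinct xs \<Longrightarrow> count_list xs i = (if i \<in> set xs then 1 else 0)"
  by (induction xs) auto

text \<open>The form belonging to \<open>i\<close> contains every variable except
  \<open>y i\<close>, so it is charged to the next variable in cyclic order, which is a different
  one and is charged once in this way. A form for \<open>t\<close> contains all variables and is
  charged to the entry of \<open>ks\<close>. Hence 1 + \<open>count_list ks i\<close> charges and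
  one more node.\<close>

lemma log_choice:
  fixes b :: "'i \<Rightarrow> real set"
  assumes I: "finite I" "2 \<le> card I" and b: "\<And>i. i \<in> I \<Longrightarrow> finite (b i)"
    and ks: "length ks = length ts" "set ks \<subseteq> I"
    and card: "\<And>i. i \<in> I \<Longrightarrow> 2 + count_list ks i \<le> card (b i)"
  shows "\<exists>y. (\<forall>i\<in>I. y i \<in> b i \<and> c + sum y (I - {i}) \<noteq> 0) \<and> (\<forall>t\<in>set ts. c + sum y I \<noteq> t)"
proof -
  obtain xs where xs: "set xs = I" "distinct xs" using finite_distinct_list[OF I(1)] by blast
  have len: "2 \<le> length xs" using I(2) xs distinct_card by metis
  define conf where "conf i = ((\<lambda>j. if j = i then 0 else 1 :: real), c)" for i :: 'i
  define extra where "extra t = ((\<lambda>_ :: 'i. 1 :: real), c - t)" for t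
  define Ls where "Ls = map extra ts @ map conf xs"
  have "list_all2 (\<lambda>L i. 0 < fst L i) (map conf xs) (rotate1 xs)"
    unfolding list_all2_conv_all_nth
  proof (intro conjI allI impI)
    fix t assume "t < length (map conf xs)"
    then have t: "t < length xs" by simp
    have "Suc t mod length xs \<noteq> t" using t len by (cases "Suc t = length xs") auto
    moreover have "Suc t mod length xs < length xs" using t by (intro mod_less_divisor) linarith
    ultimately have "xs ! (Suc t mod length xs) \<noteq> xs ! t"
      using nth_eq_iff_index_eq[OF xs(2) _ t] by blast
    then show "0 < fst (map conf xs ! t) (rotate1 xs ! t)"
      using t by (simp add: conf_def nth_rotate1)
  qed simp
  moreover have "list_all2 (\<lambda>L i. 0 < fst L i) (map extra ts) ks"
    using ks(1) by (simp add: list_all2_conv_all_nth extra_def)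
  ultimately have pos: "list_all2 (\<lambda>L i. 0 < fst L i) Ls (ks @ rotate1 xs)"
    unfolding Ls_def by (intro list_all2_appendI)
  have nonneg: "0 \<le> fst L i" if "L \<in> set Ls" for L i
    using that by (auto simp: Ls_def conf_def extra_def)
  have cnt: "Suc (count_list (ks @ rotate1 xs) i) \<le> card (b i)" if "i \<in> I" for i
    using card[OF that] that xs count_list_distinct[of "rotate1 xs" i] by simp
  have sub: "set (ks @ rotate1 xs) \<subseteq> I" using ks xs by simp
  obtain y where y: "\<And>i. i \<in> I \<Longrightarrow> y i \<in> b i" "\<And>L. L \<in> set Ls \<Longrightarrow> affine_form I L y \<noteq> 0"
    using affine_forms_nonvanishing[OF I(1) b nonneg pos sub cnt] by blast
  show ?thesis
  proof (intro exI conjI ballI)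
    fix i assume i: "i \<in> I"
    show "y i \<in> b i" using y(1)[OF i] .
    have "conf i \<in> set Ls" using i xs by (simp add: Ls_def)
    then have "affine_form I (conf i) y \<noteq> 0" using y(2) by blast
    moreover have "(\<Sum>j\<in>I - {i}. (if j = i then 0 else 1) * y j) = sum y (I - {i})"
      by (intro sum.cong) auto
    ultimately show "c + sum y (I - {i}) \<noteq> 0"
      using i I(1) by (simp add: affine_form_def conf_def sum.remove[of I i])
  next
    fix t assume "t \<in> set ts"
    then have "affine_form I (extra t) y \<noteq> 0" using y(2) by (simp add: Ls_def)
    then show "c + sum y I \<noteq> t" by (simp add: affine_form_def extra_def)
  qed
qed

text \<open>In the condition at \<open>i\<close> the factor \<open>g i\<close> stands on both sides,
  so after taking logarithms only the other summands and ln |q| remain.\<close>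

lemma abs_choice:
  fixes A :: "'i \<Rightarrow> real set"
  assumes I: "finite I" "2 \<le> card I" and A: "\<And>i. i \<in> I \<Longrightarrow> finite (A i)" "\<And>i. i \<in> I \<Longrightarrow> 0 \<notin> A i"
    and q: "q \<noteq> 0" and ks: "length ks = length fs" "set ks \<subseteq> I"
    and card: "\<And>i. i \<in> I \<Longrightarrow> 2 + count_list ks i \<le> card ((\<lambda>x. ln \<bar>x\<bar>) ` A i)"
  shows "\<exists>g. (\<forall>i\<in>I. g i \<in> A i \<and> \<bar>q * prod g I\<bar> \<noteq> \<bar>g i\<bar>) \<and>
    (\<forall>f\<in>set fs. \<bar>q * prod g I\<bar> \<noteq> \<bar>f\<bar>)"
proof -
  have "finite ((\<lambda>x. ln \<bar>x\<bar>) ` A i)" if "i \<in> I" for i using A(1)[OF that] by simp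
  moreover have "length ks = length (map (\<lambda>f. ln \<bar>f\<bar>) fs)" using ks(1) by simp
  ultimately obtain y where
    "\<forall>i\<in>I. y i \<in> (\<lambda>x. ln \<bar>x\<bar>) ` A i \<and> ln \<bar>q\<bar> + sum y (I - {i}) \<noteq> 0"
    "\<forall>t\<in>set (map (\<lambda>f. ln \<bar>f\<bar>) fs). ln \<bar>q\<bar> + sum y I \<noteq> t"
    using log_choice[OF I _ _ ks(2) card, where c = "ln \<bar>q\<bar>" and ts = "map (\<lambda>f. ln \<bar>f\<bar>) fs"] by blast
  then have y: "\<And>i. i \<in> I \<Longrightarrow> y i \<in> (\<lambda>x. ln \<bar>x\<bar>) ` A i"
    "\<And>i. i \<in> I \<Longrightarrow> ln \<bar>q\<bar> + sum y (I - {i}) \<noteq> 0"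
    "\<And>f. f \<in> set fs \<Longrightarrow> ln \<bar>q\<bar> + sum y I \<noteq> ln \<bar>f\<bar>" by auto
  have "\<exists>x. x \<in> A i \<and> ln \<bar>x\<bar> = y i" if "i \<in> I" for i using y(1)[OF that] by auto
  then obtain g where g: "\<And>i. i \<in> I \<Longrightarrow> g i \<in> A i \<and> ln \<bar>g i\<bar> = y i" by metis
  have g0: "g i \<noteq> 0" if "i \<in> I" for i using g[OF that] A(2)[OF that] by auto
  have p0: "q * prod g I \<noteq> 0" using q g0 I(1) by auto
  have "ln \<bar>prod g I\<bar> = sum y I"
    using g g0 I(1) by (simp add: abs_prod ln_prod)
  then have lnp: "ln \<bar>q * prod g I\<bar> = ln \<bar>q\<bar> + sum y I"
    using p0 by (simp add: abs_mult ln_mult)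
  show ?thesis
  proof (intro exI conjI ballI)
    fix i assume i: "i \<in> I"
    show "g i \<in> A i" using g[OF i] by simp
    show "\<bar>q * prod g I\<bar> \<noteq> \<bar>g i\<bar>"
    proof
      assume "\<bar>q * prod g I\<bar> = \<bar>g i\<bar>"
      then have "ln \<bar>q\<bar> + sum y I = y i" using lnp g[OF i] by simp
      then show False using y(2)[OF i] i I(1) by (simp add: sum.remove[of I i])
    qed
  next
    fix f assume "f \<in> set fs"
    then show "\<bar>q * prod g I\<bar> \<noteq> \<bar>f\<bar>" using y(3)[of f] lnp by auto
  qed
qed

text \<open>Each absolute value occurs at most twice among four labels. If there are only two, the
  list must be {a, -a, b, -b}.\<close>

lemma ln_abs_image_card:
  fixes A :: "real set"
  assumes "card A = 4" "0 \<notin> A"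
  shows "2 \<le> card ((\<lambda>x. ln \<bar>x\<bar>) ` A)"
    "3 \<le> card ((\<lambda>x. ln \<bar>x\<bar>) ` A) \<or> (\<forall>x\<in>A. - x \<in> A)"
proof -
  have fin: "finite A" using assms(1) by (metis card.infinite zero_neq_numeral)
  have val: "x = exp s \<or> x = - exp s" if "x \<in> A" "ln \<bar>x\<bar> = s" for x s
  proof -
    have "x \<noteq> 0" using that(1) assms(2) by auto
    then have "\<bar>x\<bar> = exp s" by (simp flip: that(2))
    then show ?thesis by linarith
  qed
  show "2 \<le> card ((\<lambda>x. ln \<bar>x\<bar>) ` A)"
  proof (rule ccontr)
    assume "\<not> ?thesis"
    then have "card ((\<lambda>x. ln \<bar>x\<bar>) ` A) \<le> Suc 0" by simp
    then obtain s where "\<And>x. x \<in> A \<Longrightarrow> ln \<bar>x\<bar> = s"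
      using fin by (metis (mono_tags, lifting) card_le_Suc0_iff_eq finite_imageI imageI)
    then have "A \<subseteq> {exp s, - exp s}" using val by blast
    then have "card A \<le> card {exp s, - exp s}" by (intro card_mono) auto
    then show False using assms(1) by (simp add: card_insert_if split: if_splits)
  qed
  show "3 \<le> card ((\<lambda>x. ln \<bar>x\<bar>) ` A) \<or> (\<forall>x\<in>A. - x \<in> A)"
  proof (cases "3 \<le> card ((\<lambda>x. ln \<bar>x\<bar>) ` A)")
    case False
    then have "card ((\<lambda>x. ln \<bar>x\<bar>) ` A) = 2" using \<open>2 \<le> _\<close> by linarith
    then obtain s t where st: "(\<lambda>x. ln \<bar>x\<bar>) ` A = {s, t}" by (auto simp: card_2_iff)
    have "A \<subseteq> {exp s, - exp s, exp t, - exp t}"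
    proof
      fix x assume "x \<in> A"
      moreover from this have "ln \<bar>x\<bar> = s \<or> ln \<bar>x\<bar> = t" using st by blast
      ultimately show "x \<in> {exp s, - exp s, exp t, - exp t}" using val by blast
    qed
    moreover have "card {exp s, - exp s, exp t, - exp t} \<le> 4" by (simp add: card_insert_if)
    ultimately have "A = {exp s, - exp s, exp t, - exp t}"
      using assms(1) by (intro card_seteq) auto
    then show ?thesis by auto
  qed blast
qed

lemma abs_avoid:
  fixes A :: "real set"
  assumes "card A = 4" "0 \<notin> A"
  obtains x where "x \<in> A" "\<bar>x\<bar> \<noteq> t"
proof -
  \<comment> \<open>If \<open>t\<close> is not positive, \<open>ln t\<close> is merely some real
    number; a label with a different logarithm still has an absolute value other than
    \<open>t\<close>.\<close>
  have "\<not> (\<lambda>x. ln \<bar>x\<bar>) ` A \<subseteq> {ln t}"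
    using ln_abs_image_card(1)[OF assms] card_mono[of "{ln t}" "(\<lambda>x. ln \<bar>x\<bar>) ` A"] by auto
  then show thesis using that by auto
qed

lemma card_avoid:
  assumes "card A = 4" "finite X" "card X \<le> 3"
  obtains x where "x \<in> A" "x \<notin> X"
proof -
  have "\<not> A \<subseteq> X" using card_mono[OF assms(2), of A] assms by auto
  then show thesis using that by blast
qed

lemma avoid_three: "card A = 4 \<Longrightarrow> \<exists>x\<in>A. x \<noteq> a \<and> x \<noteq> b \<and> x \<noteq> c"
  using card_avoid[of A "{a, b, c}"] card_length[of "[a, b, c]"] by auto

lemma card_le_two_cover:
  assumes "finite F" "card F \<le> 2"
  obtains f1 f2 where "F \<subseteq> {f1, f2}"
proof -
  consider "card F = 0" | "card F = 1" | "card F = 2" using assms(2) by linarith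
  then show thesis
  proof cases
    case 1 then show thesis using that assms(1) by auto
  next
    case 2 then show thesis using that by (auto simp: card_1_singleton_iff)
  next
    case 3 then show thesis using that by (auto simp: card_2_iff)
  qed
qed

section \<open>Recovering the signs\<close>

lemma prod_flip:
  fixes g :: "'i \<Rightarrow> real"
  assumes "finite I" "k \<in> I"
  shows "prod (g(k := - g k)) I = - prod g I"
proof -
  have "prod (g(k := - g k)) (I - {k}) = prod g (I - {k})" by (intro prod.cong) auto
  then show ?thesis using assms by (simp add: prod.remove[of I k])
qed

text \<open>All coordinates but \<open>k\<close> are chosen negative and the sign of coordinate \<open>k\<close> makes the
  product positive, so that only coordinate \<open>k\<close> can equal the product.\<close>

lemma symmetric_lists_choice:
  fixes A :: "'i \<Rightarrow> real set"
  assumes I: "finite I" "2 \<le> card I" and A: "\<And>i. i \<in> I \<Longrightarrow> card (A i) = 4 \<and> 0 \<notin> A i"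
    and sym: "\<And>i x. i \<in> I \<Longrightarrow> x \<in> A i \<Longrightarrow> - x \<in> A i" and q: "q \<noteq> 0"
  shows "\<exists>g. (\<forall>i\<in>I. g i \<in> A i \<and> q * prod g I \<noteq> g i) \<and> \<bar>q * prod g I\<bar> \<noteq> \<bar>f\<bar>"
proof -
  obtain k m where km: "k \<in> I" "m \<in> I" "k \<noteq> m"
    using I by (metis card_le_Suc0_iff_eq not_less_eq_eq numeral_2_eq_2)
  have negative: "\<exists>x\<in>A i. x < 0 \<and> \<bar>x\<bar> \<noteq> t" if i: "i \<in> I" for i t
  proof -
    obtain x where "x \<in> A i" "\<bar>x\<bar> \<noteq> t" using abs_avoid[of "A i" t] A[OF i] by blast
    moreover from this have "x \<noteq> 0" using A[OF i] by auto
    ultimately show ?thesis using sym[OF i, of x] by (cases "x < 0") force+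
  qed
  have "\<exists>x. x \<in> A i \<and> x < 0" if "i \<in> I" for i using negative[OF that] by blast
  then obtain h where h: "\<And>i. i \<in> I \<Longrightarrow> h i \<in> A i \<and> h i < 0" by metis
  define P where "P = q * prod h (I - {k} - {m})"
  have P0: "P \<noteq> 0" using q h I(1) by (force simp: P_def)
  \<comment> \<open>Coordinate \<open>k\<close> could equal the product only if
    \<open>P * x = 1\<close>; this choice of \<open>x\<close> excludes that whatever
    \<open>w\<close> will be.\<close>
  obtain x where x: "x \<in> A m" "x < 0" "\<bar>x\<bar> \<noteq> 1 / \<bar>P\<bar>" using negative[OF km(2)] by blast
  obtain z where z: "z \<in> A k" "\<bar>z\<bar> \<noteq> \<bar>f\<bar> / \<bar>P * x\<bar>"
    using abs_avoid[of "A k"] A[OF km(1)] by blast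
  define w where "w = (if P * x * z > 0 then z else - z)"
  have "z \<noteq> 0" using z A[OF km(1)] by auto
  then have w: "w \<in> A k" "\<bar>w\<bar> = \<bar>z\<bar>" "P * x * w > 0" "w \<noteq> 0"
    using z sym[OF km(1)] x P0 by (auto simp: w_def not_less order.order_iff_strict)
  define g where "g = h(m := x, k := w)"
  have "prod g I = w * (x * prod g (I - {k} - {m}))"
    using I(1) km by (simp add: prod.remove[of I k] prod.remove[of "I - {k}" m] g_def)
  moreover have "prod g (I - {k} - {m}) = prod h (I - {k} - {m})"
    by (intro prod.cong) (auto simp: g_def)
  ultimately have p: "q * prod g I = P * x * w" by (simp add: P_def)
  show ?thesis
  proof (intro exI conjI ballI)
    fix i assume i: "i \<in> I"
    show "g i \<in> A i" using h[OF i] x w by (simp add: g_def)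
    show "q * prod g I \<noteq> g i"
    proof (cases "i = k")
      case True
      have "\<bar>P * x\<bar> \<noteq> 1" using x(3) P0 by (auto simp: abs_mult field_simps)
      then have "P * x * w \<noteq> w" using w(4) by auto
      then show ?thesis using True p by (simp add: g_def)
    next
      case False
      then have "g i < 0" using h[OF i] x by (simp add: g_def)
      then show ?thesis using p w(3) by simp
    qed
  next
    show "\<bar>q * prod g I\<bar> \<noteq> \<bar>f\<bar>"
      unfolding p abs_mult[of "P * x"] w(2) using z(2) P0 x(2) by (auto simp: field_simps)
  qed
qed

text \<open>If both signs were forbidden, \<open>f1\<close> and \<open>f2\<close> would be
  \<open>x\<close> and \<open>-x\<close>, hence of equal absolute value.\<close>

lemma sign_avoid:
  fixes x :: real
  assumes "F \<subseteq> {f1, f2}" "x \<noteq> 0" "\<bar>x\<bar> \<noteq> \<bar>f1\<bar> \<or> \<bar>f1\<bar> \<noteq> \<bar>f2\<bar>"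
  shows "x \<notin> F \<or> - x \<notin> F"
proof (rule ccontr)
  assume "\<not> ?thesis"
  then have "x = f1 \<or> x = f2" "- x = f1 \<or> - x = f2" using assms(1) by blast+
  then show False using assms(2,3) by auto
qed

text \<open>Passing to \<open>ln \<bar>x\<bar>\<close> makes the conditions affine. A list with only two absolute values is closed
  under negation, and flipping a sign there makes up for the missing third value.\<close>

lemma leaf_choice:
  fixes A :: "'i \<Rightarrow> real set"
  assumes I: "finite I" "2 \<le> card I" and A: "\<And>i. i \<in> I \<Longrightarrow> card (A i) = 4 \<and> 0 \<notin> A i"
    and q: "q \<noteq> 0" and F: "finite F" "card F \<le> 2"
  obtains g where "\<And>i. i \<in> I \<Longrightarrow> g i \<in> A i" "q * prod g I \<notin> F"
    "\<And>i. i \<in> I \<Longrightarrow> q * prod g I \<noteq> g i"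
proof -
  note goal = that
  let ?b = "\<lambda>i. (\<lambda>x. ln \<bar>x\<bar>) ` A i"
  obtain f1 f2 where f: "F \<subseteq> {f1, f2}" using card_le_two_cover[OF F] .
  have finA: "finite (A i)" "0 \<notin> A i" if "i \<in> I" for i
    using A[OF that] by (auto intro: card_ge_0_finite)
  have two: "2 \<le> card (?b i)" and three: "3 \<le> card (?b i) \<or> (\<forall>x\<in>A i. - x \<in> A i)" if "i \<in> I" for i
    using ln_abs_image_card[of "A i"] A[OF that] by blast+
  \<comment> \<open>The conditions on \<open>g\<close> concern absolute values, so they survive a
    change of one sign, which negates the product.\<close>
  have flip: thesis
    if g: "\<forall>i\<in>I. g i \<in> A i \<and> \<bar>q * prod g I\<bar> \<noteq> \<bar>g i\<bar>"
      and k: "k \<in> I" "\<forall>x\<in>A k. - x \<in> A k" and np: "q * prod g I \<notin> F \<or> - (q * prod g I) \<notin> F"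
    for g k
  proof (cases "q * prod g I \<in> F")
    case True
    have p: "q * prod (g(k := - g k)) I = - (q * prod g I)" using prod_flip[OF I(1) k(1)] by simp
    show thesis
    proof (rule goal)
      show "q * prod (g(k := - g k)) I \<notin> F" using True np p by simp
      fix i assume i: "i \<in> I"
      show "(g(k := - g k)) i \<in> A i" using g k i by auto
      have "\<bar>q * prod (g(k := - g k)) I\<bar> \<noteq> \<bar>(g(k := - g k)) i\<bar>"
        unfolding p using g i by auto
      then show "q * prod (g(k := - g k)) I \<noteq> (g(k := - g k)) i" by metis
    qed
  next
    case False
    have "q * prod g I \<noteq> g i" if "i \<in> I" for i using g that by fastforce
    then show thesis using goal[of g] g False by blast
  qed
  \<comment> \<open>A third absolute value in a list pays for one extra affine condition. With
    \<open>thick\<close> lists both forbidden values are excluded this way; in \<open>mixed\<close>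
    one is excluded by the list of \<open>k\<close> and the other by a sign flip at
    \<open>m\<close>.\<close>
  consider (thick) "\<forall>i\<in>I. 3 \<le> card (?b i)"
    | (mixed) k m where "k \<in> I" "3 \<le> card (?b k)" "m \<in> I" "\<forall>x\<in>A m. - x \<in> A m"
    | (thin) "\<forall>i\<in>I. \<forall>x\<in>A i. - x \<in> A i" using three by blast
  then show thesis
  proof cases
    case thick
    obtain k m where km: "k \<in> I" "m \<in> I" "k \<noteq> m"
      using I by (metis card_le_Suc0_iff_eq not_less_eq_eq numeral_2_eq_2)
    obtain g where g: "\<forall>i\<in>I. g i \<in> A i \<and> \<bar>q * prod g I\<bar> \<noteq> \<bar>g i\<bar>"
      "\<forall>f\<in>set [f1, f2]. \<bar>q * prod g I\<bar> \<noteq> \<bar>f\<bar>"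
    proof (rule exE[OF abs_choice[where A = A and ks = "[k, m]" and fs = "[f1, f2]", OF I finA q]])
      show "2 + count_list [k, m] i \<le> card (?b i)" if "i \<in> I" for i
        using thick that km(3) by force
    qed (use km in auto)
    then have "q * prod g I \<notin> F" using f by auto
    moreover have "q * prod g I \<noteq> g i" if "i \<in> I" for i using g(1) that by fastforce
    ultimately show thesis using goal[of g] g(1) by blast
  next
    case mixed
    obtain g where g: "\<forall>i\<in>I. g i \<in> A i \<and> \<bar>q * prod g I\<bar> \<noteq> \<bar>g i\<bar>"
      "\<forall>f\<in>set [f1]. \<bar>q * prod g I\<bar> \<noteq> \<bar>f\<bar>"
    proof (rule exE[OF abs_choice[where A = A and ks = "[k]" and fs = "[f1]", OF I finA q]])
      show "2 + count_list [k] i \<le> card (?b i)" if "i \<in> I" for i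
        using two[OF that] mixed by auto
    qed (use mixed in auto)
    have "q * prod g I \<noteq> 0" using q g(1) finA(2) I(1) by auto
    then show thesis using sign_avoid[OF f] g(2) flip[OF g(1) mixed(3,4)] by simp
  next
    case thin
    obtain k where k: "k \<in> I" using I by fastforce
    show thesis
    \<comment> \<open>If the absolute values agree, missing one misses both forbidden values. If
      they differ, the product and its negative cannot both be forbidden, and a flip
      suffices.\<close>
    proof (cases "\<bar>f1\<bar> = \<bar>f2\<bar>")
      case True
      obtain g where g: "\<forall>i\<in>I. g i \<in> A i \<and> q * prod g I \<noteq> g i" "\<bar>q * prod g I\<bar> \<noteq> \<bar>f1\<bar>"
        using symmetric_lists_choice[where A = A and f = f1, OF I A _ q] thin by blast
      then have "q * prod g I \<notin> F" using f True by auto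
      then show thesis using goal[of g] g(1) by blast
    next
      case False
      obtain g where g: "\<forall>i\<in>I. g i \<in> A i \<and> \<bar>q * prod g I\<bar> \<noteq> \<bar>g i\<bar>"
      proof (rule exE[OF abs_choice[where A = A and ks = "[]" and fs = "[]", OF I finA q]])
        show "2 + count_list [] i \<le> card (?b i)" if "i \<in> I" for i using two[OF that] by simp
      qed auto
      have "q * prod g I \<noteq> 0" using q g(1) finA(2) I(1) by auto
      then show thesis using sign_avoid[OF f] False flip[OF g(1) k] thin k by simp
    qed
  qed
qed

text \<open>\<open>R1\<close> holds the leaf edges and \<open>R2\<close> the inner edges of pendant
  paths, which must only avoid 1. With two leaves the labels on \<open>R2\<close> can be fixed and
  absorbed into \<open>q\<close>; otherwise a label on \<open>R2\<close> is free to steer the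
  product.\<close>

lemma branch_choice:
  fixes A :: "'i \<Rightarrow> real set"
  assumes R: "finite R1" "finite R2" "R1 \<inter> R2 = {}" "2 \<le> card R1 \<or> R2 \<noteq> {}"
    and A: "\<And>i. i \<in> R1 \<union> R2 \<Longrightarrow> card (A i) = 4 \<and> 0 \<notin> A i"
    and q: "q \<noteq> 0" and F: "finite F" "card F \<le> 2"
  obtains g where "\<And>i. i \<in> R1 \<union> R2 \<Longrightarrow> g i \<in> A i" "\<And>i. i \<in> R2 \<Longrightarrow> g i \<noteq> 1"
    "q * prod g R1 * prod g R2 \<notin> F" "\<And>i. i \<in> R1 \<Longrightarrow> q * prod g R1 * prod g R2 \<noteq> g i"
proof -
  have "\<exists>x\<in>A i. x \<noteq> 1" if "i \<in> R1 \<union> R2" for i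
    using card_avoid[of "A i" "{1}"] A[OF that] by auto
  then obtain h where h: "\<And>i. i \<in> R1 \<union> R2 \<Longrightarrow> h i \<in> A i \<and> h i \<noteq> 1" by metis
  have h0: "h i \<noteq> 0" if "i \<in> R1 \<union> R2" for i using h[OF that] A[OF that] by auto
  show thesis
  proof (cases "2 \<le> card R1")
    case True
    have "q * prod h R2 \<noteq> 0" using q h0 R(2) by auto
    then obtain g where g: "\<And>i. i \<in> R1 \<Longrightarrow> g i \<in> A i" "q * prod h R2 * prod g R1 \<notin> F"
      "\<And>i. i \<in> R1 \<Longrightarrow> q * prod h R2 * prod g R1 \<noteq> g i"
      using leaf_choice[where A = A, OF R(1) True _ _ F, of "q * prod h R2"] A by blast
    define g' where "g' i = (if i \<in> R1 then g i else h i)" for i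
    have g': "g' i = g i" if "i \<in> R1" for i using that by (simp add: g'_def)
    have h': "g' i = h i" if "i \<in> R2" for i using that R(3) by (auto simp: g'_def)
    have "prod g' R1 = prod g R1" "prod g' R2 = prod h R2" using g' h' by (auto intro: prod.cong)
    then have p: "q * prod g' R1 * prod g' R2 = q * prod h R2 * prod g R1" by simp
    show thesis
    proof (rule that[of g'])
      show "g' i \<in> A i" if "i \<in> R1 \<union> R2" for i
        using that g' h' g(1)[of i] h[of i] by auto
      show "g' i \<noteq> 1" if "i \<in> R2" for i using that h' h[of i] by auto
      show "q * prod g' R1 * prod g' R2 \<noteq> g' i" if "i \<in> R1" for i
        unfolding p using g(3)[OF that] g'[OF that] by simp
    qed (unfold p, rule g(2))
  next
    case False
    then obtain k where k: "k \<in> R2" using R(4) by auto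
    define Q where "Q = q * prod h (R2 - {k})"
    have Q: "Q \<noteq> 0" using q h0 R(2) by (auto simp: Q_def)
    have "card R1 = 0 \<or> card R1 = 1" using False by linarith
    then consider "R1 = {}" | r where "R1 = {r}" using R(1) by (auto simp: card_1_singleton_iff)
    then show thesis
    proof cases
      case 1
      \<comment> \<open>Three values at most: 1, and one for each element of
        \<open>F\<close>.\<close>
      have "card (insert 1 ((\<lambda>f. f / Q) ` F)) \<le> 3"
        using card_image_le[OF F(1), of "\<lambda>f. f / Q"] F by (simp add: card_insert_if)
      then obtain x where x: "x \<in> A k" "x \<notin> insert 1 ((\<lambda>f. f / Q) ` F)"
        using card_avoid[of "A k" "insert 1 ((\<lambda>f. f / Q) ` F)"] A[of k] k F(1) by auto
      have "prod (h(k := x)) R2 = x * prod h (R2 - {k})"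
        using R(2) k by (simp add: prod.remove[of R2 k])
      moreover have "x * Q \<notin> F" using x(2) Q by (force simp: image_iff)
      ultimately show thesis using that[of "h(k := x)"] 1 h x by (simp add: Q_def ac_simps)
    next
      case (2 r)
      \<comment> \<open>\<open>Q * x\<close> differs from 1, so the product differs from the leaf
        label \<open>z\<close> for every nonzero \<open>z\<close>, and only the values in
        \<open>F\<close> restrict \<open>z\<close>.\<close>
      obtain x where x: "x \<in> A k" "x \<noteq> 1" "x \<noteq> 1 / Q"
        using avoid_three[of "A k" 1 "1 / Q" 1] A[of k] k by auto
      have x0: "x \<noteq> 0" using x A[of k] k by auto
      have "card ((\<lambda>f. f / (Q * x)) ` F) \<le> 3"
        using card_image_le[OF F(1), of "\<lambda>f. f / (Q * x)"] F(2) by simp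
      then obtain z where z: "z \<in> A r" "z \<notin> (\<lambda>f. f / (Q * x)) ` F"
        using card_avoid[of "A r" "(\<lambda>f. f / (Q * x)) ` F"] A[of r] 2 F(1) by auto
      have rk: "r \<noteq> k" "r \<notin> R2" using 2 R(3) k by auto
      have z0: "z \<noteq> 0" using z A[of r] 2 by auto
      define g where "g = h(k := x, r := z)"
      have "prod g (R2 - {k}) = prod h (R2 - {k})" using rk by (intro prod.cong) (auto simp: g_def)
      then have "prod g R2 = x * prod h (R2 - {k})"
        using R(2) k rk by (simp add: prod.remove[of R2 k] g_def)
      then have p: "q * prod g R1 * prod g R2 = z * (Q * x)" using 2 by (simp add: Q_def g_def)
      moreover have "z * (Q * x) \<notin> F" using z(2) Q x0 by (force simp: image_iff)
      moreover have "z * (Q * x) \<noteq> z" using z0 x(3) Q by (auto simp: field_simps)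
      moreover have "g i \<in> A i" if "i \<in> R1 \<union> R2" for i
        using that 2 h[of i] x(1) z(1) by (auto simp: g_def)
      moreover have "g i \<noteq> 1" if "i \<in> R2" for i
        using that rk h[of i] x(2) by (auto simp: g_def)
      moreover have "g i = z" if "i \<in> R1" for i using that 2 by (simp add: g_def)
      ultimately show thesis using that[of g] by simp
    qed
  qed
qed

text \<open>The value 1 stands for the empty product, so that vertices with and without a leaf edge
  share their formulas.\<close>

lemma optional_choice:
  assumes "finite R" "card R \<le> 1" "\<And>r. r \<in> R \<Longrightarrow> card (A r) = 4"
  obtains x where "R = {} \<Longrightarrow> x = 1" "\<And>r. r \<in> R \<Longrightarrow> x \<in> A r" "R \<noteq> {} \<Longrightarrow> x \<noteq> a \<and> x \<noteq> b"
proof -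
  have "card R = 0 \<or> card R = 1" using assms(2) by linarith
  then consider "R = {}" | r where "R = {r}" using assms(1) by (auto simp: card_1_singleton_iff)
  then show thesis
  proof cases
    case 1 then show thesis using that[of 1] by simp
  next
    case (2 r) then show thesis using that avoid_three[of "A r" a b a] assms(3)[of r] by auto
  qed
qed

lemma prod_constant_le_one:
  fixes x :: real
  assumes "finite R" "card R \<le> 1" "\<And>r. r \<in> R \<Longrightarrow> g r = x" "R = {} \<Longrightarrow> x = 1"
  shows "prod g R = x"
proof -
  have "card R = 0 \<or> card R = 1" using assms(2) by linarith
  then show ?thesis using assms by (auto simp: card_1_singleton_iff)
qed

text \<open>Here \<open>ab\<close> and \<open>bc\<close> are the middle edges of a path \<open>x, a, b, c, y\<close> whose outer edges carry the
  labels \<open>e\<close> and \<open>f\<close>, the sets \<open>RA\<close>, \<open>RB\<close>, \<open>RC\<close> contain the at most one leaf edge at \<open>a\<close>, \<open>b\<close>, \<open>c\<close>,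
  and \<open>s\<close>, \<open>t\<close> are the products at \<open>x\<close> and \<open>y\<close>.\<close>

lemma thread_choice:
  fixes A :: "'i \<Rightarrow> real set"
  assumes fin: "finite RA" "finite RB" "finite RC" and le1: "card RA \<le> 1" "card RB \<le> 1" "card RC \<le> 1"
    and dis: "RA \<inter> RB = {}" "RA \<inter> RC = {}" "RB \<inter> RC = {}" "ab \<noteq> bc"
      "ab \<notin> RA \<union> RB \<union> RC" "bc \<notin> RA \<union> RB \<union> RC"
    and A: "\<And>i. i \<in> {ab, bc} \<union> RA \<union> RB \<union> RC \<Longrightarrow> card (A i) = 4 \<and> 0 \<notin> A i"
    and ef: "e \<noteq> 0" "f \<noteq> 0"
  obtains g where "\<And>i. i \<in> {ab, bc} \<union> RA \<union> RB \<union> RC \<Longrightarrow> g i \<in> A i"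
    "e * g ab * prod g RA \<noteq> s" "e * g ab * prod g RA \<noteq> g ab * g bc * prod g RB"
    "g ab * g bc * prod g RB \<noteq> f * g bc * prod g RC" "f * g bc * prod g RC \<noteq> t"
    "\<And>i. i \<in> RA \<Longrightarrow> e * g ab * prod g RA \<noteq> g i"
    "\<And>i. i \<in> RB \<Longrightarrow> g ab * g bc * prod g RB \<noteq> g i"
    "\<And>i. i \<in> RC \<Longrightarrow> f * g bc * prod g RC \<noteq> g i"
proof -
  have A4: "card (A i) = 4" "0 \<notin> A i" if "i \<in> {ab, bc} \<union> RA \<union> RB \<union> RC" for i
    using A[OF that] by auto
  \<comment> \<open>\<open>s / e\<close> matters when \<open>a\<close> has no leaf,
    \<open>1 / e\<close> when it has one, and \<open>f\<close> separates \<open>b\<close> from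
    \<open>c\<close> when neither has a leaf.\<close>
  obtain \<alpha> where \<alpha>: "\<alpha> \<in> A ab" "\<alpha> \<noteq> s / e" "\<alpha> \<noteq> 1 / e" "\<alpha> \<noteq> f"
    using avoid_three[of "A ab" "s / e" "1 / e" f] A4 by auto
  \<comment> \<open>The analogues at \<open>c\<close> must share one slot: without a leaf at
    \<open>c\<close> the value \<open>t\<close> has to be avoided here, with a leaf only the product
    1 of the other two labels at \<open>c\<close>. The value \<open>e\<close> separates
    \<open>a\<close> from \<open>b\<close> without leaves, and \<open>1 / \<alpha>\<close> serves a
    leaf at \<open>b\<close>.\<close>
  obtain \<beta> where \<beta>: "\<beta> \<in> A bc" "\<beta> \<noteq> (if RC = {} then t / f else 1 / f)" "\<beta> \<noteq> e" "\<beta> \<noteq> 1 / \<alpha>"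
    using avoid_three[of "A bc" "if RC = {} then t / f else 1 / f" e "1 / \<alpha>"] A4 by auto
  \<comment> \<open>The leaf label at \<open>b\<close> looks after a neighbour \<open>a\<close> or
    \<open>c\<close> that has no leaf; a neighbour with a leaf adjusts afterwards, when
    \<open>pb\<close> is known.\<close>
  obtain \<mu>b where \<mu>b: "RB = {} \<Longrightarrow> \<mu>b = 1" "\<And>r. r \<in> RB \<Longrightarrow> \<mu>b \<in> A r"
    "RB \<noteq> {} \<Longrightarrow> \<mu>b \<noteq> e / \<beta> \<and> \<mu>b \<noteq> f / \<alpha>"
    by (rule optional_choice[OF fin(2) le1(2), where A = A and a = "e / \<beta>" and b = "f / \<alpha>"])
      (use A4 in auto)
  define pb where "pb = \<alpha> * \<beta> * \<mu>b"
  obtain \<mu>a where \<mu>a: "RA = {} \<Longrightarrow> \<mu>a = 1" "\<And>r. r \<in> RA \<Longrightarrow> \<mu>a \<in> A r"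
    "RA \<noteq> {} \<Longrightarrow> \<mu>a \<noteq> s / (e * \<alpha>) \<and> \<mu>a \<noteq> pb / (e * \<alpha>)"
    by (rule optional_choice[OF fin(1) le1(1), where A = A and a = "s / (e * \<alpha>)" and b = "pb / (e * \<alpha>)"])
      (use A4 in auto)
  obtain \<mu>c where \<mu>c: "RC = {} \<Longrightarrow> \<mu>c = 1" "\<And>r. r \<in> RC \<Longrightarrow> \<mu>c \<in> A r"
    "RC \<noteq> {} \<Longrightarrow> \<mu>c \<noteq> t / (f * \<beta>) \<and> \<mu>c \<noteq> pb / (f * \<beta>)"
    by (rule optional_choice[OF fin(3) le1(3), where A = A and a = "t / (f * \<beta>)" and b = "pb / (f * \<beta>)"])
      (use A4 in auto)
  have nz: "\<alpha> \<noteq> 0" "\<beta> \<noteq> 0" using \<alpha>(1) \<beta>(1) A4 by auto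
  define g where "g i = (if i \<in> RA then \<mu>a else if i \<in> RB then \<mu>b else if i \<in> RC then \<mu>c
    else if i = ab then \<alpha> else \<beta>)" for i
  have gR: "g i = \<mu>a" if "i \<in> RA" for i using that by (simp add: g_def)
  have gB: "g i = \<mu>b" if "i \<in> RB" for i using that dis by (auto simp: g_def)
  have gC: "g i = \<mu>c" if "i \<in> RC" for i using that dis by (auto simp: g_def)
  have gab: "g ab = \<alpha>" "g bc = \<beta>" using dis by (auto simp: g_def)
  have pR: "prod g RA = \<mu>a" "prod g RB = \<mu>b" "prod g RC = \<mu>c"
    using prod_constant_le_one[OF fin(1) le1(1), of g] prod_constant_le_one[OF fin(2) le1(2), of g]
      prod_constant_le_one[OF fin(3) le1(3), of g] gR gB gC \<mu>a(1) \<mu>b(1) \<mu>c(1) by auto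
  show thesis
  proof (rule that[of g])
    fix i assume "i \<in> {ab, bc} \<union> RA \<union> RB \<union> RC"
    then show "g i \<in> A i" using gR gB gC gab \<alpha>(1) \<beta>(1) \<mu>a(2) \<mu>b(2) \<mu>c(2) by auto
  next
    show "e * g ab * prod g RA \<noteq> s"
      using \<alpha> \<mu>a nz ef by (cases "RA = {}") (auto simp: gab pR field_simps)
    show "e * g ab * prod g RA \<noteq> g ab * g bc * prod g RB"
    proof (cases "RA = {}")
      case True
      then show ?thesis using \<mu>a(1) \<beta>(3) \<mu>b(1,3) nz by (cases "RB = {}") (auto simp: gab pR field_simps)
    next
      case False
      then show ?thesis using \<mu>a(3) nz ef by (auto simp: gab pR pb_def field_simps)
    qed
    show "g ab * g bc * prod g RB \<noteq> f * g bc * prod g RC"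
    proof (cases "RC = {}")
      case True
      then show ?thesis using \<mu>c(1) \<alpha>(4) \<mu>b(1,3) nz by (cases "RB = {}") (auto simp: gab pR field_simps)
    next
      case False
      then show ?thesis using \<mu>c(3) nz ef by (auto simp: gab pR pb_def field_simps)
    qed
    show "f * g bc * prod g RC \<noteq> t"
      using \<beta>(2) \<mu>c nz ef by (cases "RC = {}") (auto simp: gab pR field_simps)
  next
    fix i assume i: "i \<in> RA"
    then have "\<mu>a \<noteq> 0" using \<mu>a(2)[OF i] A4(2)[of i] by auto
    then show "e * g ab * prod g RA \<noteq> g i"
      using \<alpha>(3) ef by (auto simp: gab pR gR[OF i] field_simps)
  next
    fix i assume i: "i \<in> RB"
    then have "\<mu>b \<noteq> 0" using \<mu>b(2)[OF i] A4(2)[of i] by auto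
    then show "g ab * g bc * prod g RB \<noteq> g i"
      using \<beta>(4) nz by (auto simp: gab pR gB[OF i] field_simps)
  next
    fix i assume i: "i \<in> RC"
    then have "\<mu>c \<noteq> 0" "RC \<noteq> {}" using \<mu>c(2)[OF i] A4(2)[of i] by auto
    then show "f * g bc * prod g RC \<noteq> g i"
      using \<beta>(2) ef by (auto simp: gab pR gC[OF i] field_simps)
  qed
qed

section \<open>Reductions\<close>

definition edge_prod :: "'a set set \<Rightarrow> ('a set \<Rightarrow> real) \<Rightarrow> 'a \<Rightarrow> real" where
  "edge_prod E l v = prod l (inc E v)"

text \<open>Isolated edges are exempt, so that the notion survives the deletion of edges.\<close>

definition weakly_proper :: "'a set set \<Rightarrow> ('a set \<Rightarrow> real) \<Rightarrow> bool" where
  "weakly_proper E l \<longleftrightarrow> (\<forall>u v. {u, v} \<in> E \<longrightarrow> inc E u \<noteq> {{u, v}} \<or> inc E v \<noteq> {{u, v}} \<longrightarrow>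
     edge_prod E l u \<noteq> edge_prod E l v)"

text \<open>Nothing is asked of the degree of \<open>w\<close>, so an isolated edge is a leaf edge
  at both its ends.\<close>

definition leaf_edges :: "'a set set \<Rightarrow> 'a \<Rightarrow> 'a set set" where
  "leaf_edges E w = {e \<in> inc E w. \<exists>v. e = {w, v} \<and> v \<noteq> w \<and> inc E v = {e}}"

text \<open>The outer edge \<open>uv\<close> of a pendant path \<open>w, u, v\<close> can be labelled last, which leaves for its
  inner edge \<open>wu\<close> only the condition that the label differs from 1.\<close>

definition pendant_edges :: "'a set set \<Rightarrow> 'a \<Rightarrow> 'a set set" where
  "pendant_edges E w = {e \<in> inc E w. \<exists>u v. e = {w, u} \<and> u \<noteq> w \<and> v \<noteq> u \<and> v \<noteq> w \<and>
     inc E u = {e, {u, v}} \<and> inc E v = {{u, v}}}"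

definition core_edges :: "'a set set \<Rightarrow> 'a \<Rightarrow> 'a set set" where
  "core_edges E w = inc E w - leaf_edges E w - pendant_edges E w"

lemma leaf_pendant_disjoint: "leaf_edges E w \<inter> pendant_edges E w = {}"
proof (rule equals0I)
  fix e assume "e \<in> leaf_edges E w \<inter> pendant_edges E w"
  then obtain v u v' where "e = {w, v}" "v \<noteq> w" "inc E v = {e}" "e = {w, u}" "u \<noteq> w" "v' \<noteq> w"
    "inc E u = {e, {u, v'}}" by (auto simp: leaf_edges_def pendant_edges_def)
  moreover from this have "u = v" by (auto simp: doubleton_eq_iff)
  ultimately show False by (metis doubleton_eq_iff insertI1 insert_commute singletonD)
qed

section \<open>The two reducible configurations\<close>

lemma edge_prod_cong:
  "inc E v = inc E' v \<Longrightarrow> (\<And>e. e \<in> inc E' v \<Longrightarrow> l e = l' e) \<Longrightarrow> edge_prod E l v = edge_prod E' l' v"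
  by (simp add: edge_prod_def)

text \<open>A vertex other than \<open>w\<close> that loses an edge loses all its edges, so no other
  product changes. The product at \<open>w\<close> must avoid the at most two products at its core
  neighbours and the leaf labels. The outer edges \<open>R3\<close> are labelled last, against the
  product at \<open>w\<close>.\<close>

lemma branch_reduction:
  fixes E :: "'a set set"
  assumes fin: "finite E" and card2: "\<And>e. e \<in> E \<Longrightarrow> card e = 2"
    and L: "\<And>e. e \<in> E \<Longrightarrow> card (L e) = 4 \<and> 0 \<notin> L e"
    and core: "card (core_edges E w) \<le> 2"
    and many: "2 \<le> card (leaf_edges E w) \<or> pendant_edges E w \<noteq> {}"
    and R3_def: "R3 = {f \<in> E. w \<notin> f \<and> (\<exists>e\<in>pendant_edges E w. e \<inter> f \<noteq> {})}"
    and E'_def: "E' = E - leaf_edges E w - pendant_edges E w - R3"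
    and l': "\<And>e. e \<in> E' \<Longrightarrow> l' e \<in> L e" "weakly_proper E' l'"
  shows "\<exists>l. (\<forall>e\<in>E. l e \<in> L e) \<and> weakly_proper E l"
proof -
  define R1 where "R1 = leaf_edges E w"
  define R2 where "R2 = pendant_edges E w"
  define C where "C = core_edges E w"
  have R12: "R1 \<subseteq> inc E w" "R2 \<subseteq> inc E w" "R1 \<inter> R2 = {}" "finite R1" "finite R2"
    using leaf_pendant_disjoint[of E w] finite_subset[of _ E] fin
    by (auto simp: R1_def R2_def leaf_edges_def pendant_edges_def inc_def)
  have incw: "inc E w = C \<union> R1 \<union> R2" "C \<inter> R1 = {}" "C \<inter> R2 = {}"
    using R12 by (auto simp: C_def core_edges_def R1_def R2_def)
  have w3: "w \<notin> f" if "f \<in> R3" for f using that by (simp add: R3_def)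
  have E': "E' = E - R1 - R2 - R3" by (simp add: E'_def R1_def R2_def)
  have CE': "C = inc E' w" using incw w3 R12 by (auto simp: E' inc_def)
  have R1D: "inc E v = {e}" if "e \<in> R1" "v \<in> e" "v \<noteq> w" for e v
    using that by (auto simp: R1_def leaf_edges_def)
  have R2D: "\<exists>v. e = {w, u} \<and> v \<noteq> u \<and> v \<noteq> w \<and> inc E u = {e, {u, v}} \<and> inc E v = {{u, v}} \<and> {u, v} \<in> R3"
    if e: "e \<in> R2" "u \<in> e" "u \<noteq> w" for e u
  proof -
    obtain v where v: "e = {w, u}" "v \<noteq> u" "v \<noteq> w" "inc E u = {e, {u, v}}" "inc E v = {{u, v}}"
      using e by (auto simp: R2_def pendant_edges_def)
    have "{u, v} \<in> inc E u" using v by simp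
    then have "{u, v} \<in> R3" using v e by (auto simp: R3_def R2_def inc_def)
    then show ?thesis using v by blast
  qed
  have R3D: "\<exists>e u v. e \<in> R2 \<and> e = {w, u} \<and> f = {u, v} \<and> u \<noteq> w \<and> v \<noteq> u \<and> v \<noteq> w \<and>
      inc E u = {e, f} \<and> inc E v = {f}" if f: "f \<in> R3" for f
  proof -
    obtain e u where e: "e \<in> R2" "u \<in> e" "u \<in> f" "u \<noteq> w" "f \<in> E"
      using f w3[OF f] by (auto simp: R3_def R2_def)
    then obtain v where v: "e = {w, u}" "v \<noteq> u" "v \<noteq> w" "inc E u = {e, {u, v}}"
      "inc E v = {{u, v}}" using R2D by blast
    have "f \<in> inc E u" using e by (simp add: inc_def)
    then have "f = {u, v}" using v w3[OF f] by auto
    then show ?thesis using e v by blast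
  qed
  have touch: "inc E x \<subseteq> R1 \<union> R2 \<union> R3"
    if x: "x \<noteq> w" "k \<in> inc E x" "k \<in> R1 \<union> R2 \<union> R3" for x k
  proof -
    have xk: "x \<in> k" using x by (simp add: inc_def)
    from x(3) consider "k \<in> R1" | "k \<in> R2" | "k \<in> R3" by blast
    then show ?thesis
    proof cases
      case 1 then show ?thesis using R1D[of k x] xk x(1) by auto
    next
      case 2 then show ?thesis using R2D[of k x] xk x(1) by auto
    next
      case 3
      then obtain e u v where "e \<in> R2" "k = {u, v}" "inc E u = {e, k}" "inc E v = {k}"
        using R3D[OF 3] by metis
      then show ?thesis using xk 3 by auto
    qed
  qed
  have untouched: "inc E x = inc E' x" if "x \<noteq> w" "k \<in> inc E x" "k \<notin> R1 \<union> R2 \<union> R3" for x k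
  proof -
    have "inc E x \<inter> (R1 \<union> R2 \<union> R3) = {}" using touch[of x] that by blast
    then show ?thesis by (auto simp: E' inc_def)
  qed
  define q where "q = edge_prod E' l' w"
  have E'E: "E' \<subseteq> E" by (auto simp: E')
  have l'0: "l' e \<noteq> 0" if "e \<in> E'" for e using l'(1)[OF that] L E'E that by force
  have "q \<noteq> 0"
    using l'0 finite_subset[OF E'E fin] by (auto simp: q_def edge_prod_def inc_def)
  define M where "M = {m. {w, m} \<in> C}"
  have "inj_on (\<lambda>m. {w, m}) M" by (auto simp: inj_on_def doubleton_eq_iff)
  moreover have finC: "finite C" using incw(1) fin by (metis finite_Un finite_inc)
  moreover have "(\<lambda>m. {w, m}) ` M \<subseteq> C" by (auto simp: M_def)
  ultimately have M: "finite M" "card M \<le> 2"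
    using inj_on_finite[of "\<lambda>m. {w, m}" M C] card_inj_on_le[of "\<lambda>m. {w, m}" M C] core
    unfolding C_def by linarith+
  have F: "finite (edge_prod E' l' ` M)" "card (edge_prod E' l' ` M) \<le> 2"
    using M card_image_le[of M "edge_prod E' l'"] by auto
  have L12: "card (L e) = 4 \<and> 0 \<notin> L e" if "e \<in> R1 \<union> R2" for e
    using L R12 that by (auto simp: inc_def)
  obtain g where g: "\<And>e. e \<in> R1 \<union> R2 \<Longrightarrow> g e \<in> L e" "\<And>e. e \<in> R2 \<Longrightarrow> g e \<noteq> 1"
    "q * prod g R1 * prod g R2 \<notin> edge_prod E' l' ` M"
    "\<And>e. e \<in> R1 \<Longrightarrow> q * prod g R1 * prod g R2 \<noteq> g e"
    using branch_choice[where A = L, OF R12(4,5,3) _ L12 \<open>q \<noteq> 0\<close> F] many unfolding R1_def R2_def by blast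
  define pw where "pw = q * prod g R1 * prod g R2"
  \<comment> \<open>The far end of \<open>f\<close> has degree one, so \<open>f\<close> belongs to a
    single pendant path and its label has one value to avoid.\<close>
  have unique: "e1 = e2"
    if f: "f \<in> R3" and e: "e1 \<in> R2" "e2 \<in> R2" "e1 \<inter> f \<noteq> {}" "e2 \<inter> f \<noteq> {}" for f e1 e2
  proof -
    have wf: "w \<notin> f" using w3 f by blast
    then obtain u1 u2 where u: "u1 \<in> e1" "u1 \<in> f" "u2 \<in> e2" "u2 \<in> f" "u1 \<noteq> w" "u2 \<noteq> w"
      using e by (metis disjoint_iff)
    obtain v1 where v1: "e1 = {w, u1}" "inc E u1 = {e1, {u1, v1}}" "inc E v1 = {{u1, v1}}"
      using R2D[OF e(1) u(1,5)] by blast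
    obtain v2 where v2: "e2 = {w, u2}" "inc E u2 = {e2, {u2, v2}}"
      using R2D[OF e(2) u(3,6)] by blast
    have "f \<in> inc E u1" using f u(2) by (auto simp: inc_def R3_def)
    then have "f = {u1, v1}" using v1 wf by auto
    moreover have "u2 \<noteq> v1"
    proof
      assume "u2 = v1"
      then have "e2 \<in> {{u1, v1}}" using v1(3) v2(2) by auto
      then show False using \<open>f = {u1, v1}\<close> wf v2(1) by auto
    qed
    ultimately show ?thesis using u(4) v1 v2 by auto
  qed
  have "\<exists>x. x \<in> L f \<and> (\<forall>e\<in>R2. e \<inter> f \<noteq> {} \<longrightarrow> x \<noteq> pw / g e)" if f: "f \<in> R3" for f
  proof -
    obtain e where e: "e \<in> R2" "e \<inter> f \<noteq> {}" using R3D[OF f] by blast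
    have "card (L f) = 4" using L f by (auto simp: R3_def)
    then obtain x where "x \<in> L f" "x \<noteq> pw / g e" using avoid_three[of "L f" "pw / g e"] by blast
    then show ?thesis using unique[OF f e(1) _ e(2)] by blast
  qed
  then obtain h where h: "\<And>f. f \<in> R3 \<Longrightarrow> h f \<in> L f"
    "\<And>f e. f \<in> R3 \<Longrightarrow> e \<in> R2 \<Longrightarrow> e \<inter> f \<noteq> {} \<Longrightarrow> h f \<noteq> pw / g e" by metis
  define l where "l e = (if e \<in> R1 \<union> R2 then g e else if e \<in> R3 then h e else l' e)" for e
  have l12: "l e = g e" if "e \<in> R1 \<union> R2" for e using that by (simp add: l_def)
  have l3: "l e = h e" if "e \<in> R3" for e
  proof -
    have "e \<notin> R1 \<union> R2" using w3[OF that] R12(1,2) by (auto simp: inc_def)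
    then show ?thesis using that by (simp add: l_def)
  qed
  have lE': "l e = l' e" if "e \<in> E'" for e using that by (auto simp: l_def E')
  have lL: "l e \<in> L e" if "e \<in> E" for e
    using that g(1) h(1) l'(1) by (auto simp: l_def E')
  have g0: "g e \<noteq> 0" if "e \<in> R1 \<union> R2" for e using g(1)[OF that] L12[OF that] by auto
  have h0: "h e \<noteq> 0" if "e \<in> R3" for e using h(1)[OF that] L[of e] that by (auto simp: R3_def)
  have pw: "edge_prod E l w = pw"
  proof -
    have "edge_prod E l w = prod l C * prod l R1 * prod l R2"
      unfolding edge_prod_def incw(1) using finC R12 incw
      by (simp add: prod.union_disjoint Int_Un_distrib2)
    moreover have "prod l C = q"
      unfolding q_def edge_prod_def CE' using lE' by (intro prod.cong) (auto simp: inc_def)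
    moreover have "prod l R1 = prod g R1" "prod l R2 = prod g R2"
      using l12 by (auto intro: prod.cong)
    ultimately show ?thesis by (simp add: pw_def)
  qed
  have same: "edge_prod E l x = edge_prod E' l' x" if "x \<noteq> w" "k \<in> inc E x" "k \<notin> R1 \<union> R2 \<union> R3" for x k
    using untouched[OF that] lE' by (intro edge_prod_cong) (auto simp: inc_def)
  have at_w: "pw \<noteq> edge_prod E l y" if y: "{w, y} \<in> E" "y \<noteq> w" for y
  proof -
    have "{w, y} \<in> inc E w" using y by (simp add: inc_def)
    then consider "{w, y} \<in> R1" | "{w, y} \<in> R2" | "{w, y} \<in> C" using incw by blast
    then show ?thesis
    proof cases
      case 1
      then have "inc E y = {{w, y}}" using R1D[of "{w, y}" y] y by simp
      then have "edge_prod E l y = g {w, y}" using 1 l12 by (simp add: edge_prod_def)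
      then show ?thesis using g(4)[OF 1] by (simp add: pw_def)
    next
      case 2
      then obtain v where v: "v \<noteq> w" "v \<noteq> y" "inc E y = {{w, y}, {y, v}}" "{y, v} \<in> R3"
        using R2D[of "{w, y}" y] y by auto
      have "edge_prod E l y = g {w, y} * h {y, v}"
        using v 2 l12 l3 w3[OF v(4)] by (auto simp: edge_prod_def doubleton_eq_iff)
      moreover have "h {y, v} \<noteq> pw / g {w, y}" using h(2)[OF v(4) 2] by auto
      ultimately show ?thesis using g0[of "{w, y}"] 2 by (auto simp: field_simps)
    next
      case 3
      then have "{w, y} \<notin> R1 \<union> R2 \<union> R3" using incw w3 by blast
      then have "edge_prod E l y = edge_prod E' l' y" using y by (intro same) (auto simp: inc_def)
      moreover have "y \<in> M" using 3 by (simp add: M_def)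
      ultimately show ?thesis using g(3) by (auto simp: pw_def)
    qed
  qed
  have "weakly_proper E l"
    unfolding weakly_proper_def
  proof (intro allI impI)
    fix x y assume xy: "{x, y} \<in> E" "inc E x \<noteq> {{x, y}} \<or> inc E y \<noteq> {{x, y}}"
    have "x \<noteq> y" using card2[OF xy(1)] by auto
    then consider "x \<noteq> y" "x = w" | "x \<noteq> y" "y = w" | "x \<noteq> w" "y \<noteq> w" "x \<noteq> y" by blast
    then show "edge_prod E l x \<noteq> edge_prod E l y"
    proof cases
      case 1 then show ?thesis using at_w[of y] pw xy by auto
    next
      case 2 then show ?thesis using at_w[of x] pw xy by (auto simp: insert_commute)
    next
      case 3
      show ?thesis
      proof (cases "{x, y} \<in> R3")
        case True
        then obtain e u v where e: "e \<in> R2" "{x, y} = {u, v}" "inc E u = {e, {x, y}}"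
          "inc E v = {{x, y}}" "e = {w, u}" using R3D[OF True] by metis
        have ne: "e \<noteq> {x, y}" using e(5) 3 by auto
        have "edge_prod E l u = g e * h {x, y}" "edge_prod E l v = h {x, y}"
          using e(3,4) ne l12 l3 True e(1) by (auto simp: edge_prod_def)
        then have "edge_prod E l u \<noteq> edge_prod E l v" using g(2)[OF e(1)] h0[OF True] by auto
        then show ?thesis using e(2) by (auto simp: doubleton_eq_iff)
      next
        case False
        then have n: "{x, y} \<notin> R1 \<union> R2 \<union> R3" using R12(1,2) 3 by (auto simp: inc_def)
        have k: "{x, y} \<in> inc E x" "{x, y} \<in> inc E y" using xy by (auto simp: inc_def)
        have "{x, y} \<in> E'" using n xy by (simp add: E')
        then have "edge_prod E' l' x \<noteq> edge_prod E' l' y"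
          using l'(2) xy(2) untouched[OF 3(1) k(1) n] untouched[OF 3(2) k(2) n]
          unfolding weakly_proper_def by metis
        then show ?thesis using same[OF 3(1) k(1) n] same[OF 3(2) k(2) n] by simp
      qed
    qed
  qed
  then show ?thesis using lL by blast
qed

text \<open>The outer edges \<open>{x, a}\<close> and \<open>{c, y}\<close> keep their labels, so
  the products at \<open>x\<close> and \<open>y\<close> stay fixed and enter the choice of labels as
  the constants \<open>s\<close> and \<open>t\<close>.\<close>

lemma thread_reduction:
  fixes E :: "'a set set"
  assumes fin: "finite E" and card2: "\<And>e. e \<in> E \<Longrightarrow> card e = 2"
    and L: "\<And>e. e \<in> E \<Longrightarrow> card (L e) = 4 \<and> 0 \<notin> L e"
    and abc: "a \<noteq> b" "b \<noteq> c" "a \<noteq> c" "x \<notin> {a, b, c}" "y \<notin> {a, b, c}"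
    and inc: "inc E a = {{x, a}, {a, b}} \<union> leaf_edges E a"
      "inc E b = {{a, b}, {b, c}} \<union> leaf_edges E b"
      "inc E c = {{b, c}, {c, y}} \<union> leaf_edges E c"
    and no_leaf: "{x, a} \<notin> leaf_edges E a" "{a, b} \<notin> leaf_edges E a" "{a, b} \<notin> leaf_edges E b"
      "{b, c} \<notin> leaf_edges E b" "{b, c} \<notin> leaf_edges E c" "{c, y} \<notin> leaf_edges E c"
    and le1: "card (leaf_edges E a) \<le> 1" "card (leaf_edges E b) \<le> 1" "card (leaf_edges E c) \<le> 1"
    and E'_def: "E' = E - ({{a, b}, {b, c}} \<union> leaf_edges E a \<union> leaf_edges E b \<union> leaf_edges E c)"
    and l': "\<And>e. e \<in> E' \<Longrightarrow> l' e \<in> L e" "weakly_proper E' l'"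
  shows "\<exists>l. (\<forall>e\<in>E. l e \<in> L e) \<and> weakly_proper E l"
proof -
  define R where "R = {{a, b}, {b, c}} \<union> leaf_edges E a \<union> leaf_edges E b \<union> leaf_edges E c"
  have E': "E' = E - R" by (simp add: E'_def R_def)
  have leafD: "inc E z = {{w, z}}" "z \<noteq> w" if "{w, z} \<in> leaf_edges E w" for w z
    using that by (auto simp: leaf_edges_def doubleton_eq_iff)
  have leaf_end: "\<exists>z. k = {w, z} \<and> z \<noteq> w" if "k \<in> leaf_edges E w" for k w
    using that by (auto simp: leaf_edges_def)
  have leaf_inc: "k \<in> E" "w \<in> k" if "k \<in> leaf_edges E w" for k w
    using that by (auto simp: leaf_edges_def inc_def)
  have finR: "finite (leaf_edges E w)" for w
    using fin finite_subset[of "leaf_edges E w" E] leaf_inc by blast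
  have edges: "{x, a} \<in> E" "{a, b} \<in> E" "{b, c} \<in> E" "{c, y} \<in> E"
    using inc by (auto simp: inc_def set_eq_iff)
  \<comment> \<open>Such an edge could only be a leaf edge at \<open>a\<close>, yet \<open>c\<close>
    has further edges. It is excluded so that the leaf edges at \<open>a\<close> and
    \<open>c\<close> are disjoint.\<close>
  have ac: "{a, c} \<notin> E"
  proof
    assume "{a, c} \<in> E"
    then have "{a, c} \<in> inc E a" by (simp add: inc_def)
    then have "{a, c} \<in> leaf_edges E a" unfolding inc(1) using abc by (auto simp: doubleton_eq_iff)
    then have "inc E c = {{a, c}}" by (rule leafD)
    moreover have "{b, c} \<in> inc E c" unfolding inc(3) by simp
    ultimately have "{b, c} = {a, c}" by simp
    then show False using abc by (auto simp: doubleton_eq_iff)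
  qed
  have sep: "leaf_edges E v \<inter> leaf_edges E w = {}"
    if vw: "v \<noteq> w" "{v, w} \<notin> leaf_edges E v" for v w
  proof (rule equals0I)
    fix k assume k: "k \<in> leaf_edges E v \<inter> leaf_edges E w"
    then obtain z where "k = {v, z}" using leaf_end by blast
    then have "k = {v, w}" using k leaf_inc(2)[of k w] vw(1) by auto
    then show False using k vw(2) by simp
  qed
  have dis: "leaf_edges E a \<inter> leaf_edges E b = {}" "leaf_edges E a \<inter> leaf_edges E c = {}"
    "leaf_edges E b \<inter> leaf_edges E c = {}"
    using sep[of a b] sep[of b c] sep[of a c] abc no_leaf ac leaf_inc by blast+
  have ne: "{a, b} \<noteq> {b, c}" using abc by (auto simp: doubleton_eq_iff)
  have nab: "{a, b} \<notin> leaf_edges E c" "{b, c} \<notin> leaf_edges E a"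
    using leaf_inc(2) abc by blast+
  have outer: "{x, a} \<notin> R" "{c, y} \<notin> R"
    using no_leaf abc leaf_inc(2)[of "{x, a}"] leaf_inc(2)[of "{c, y}"]
    by (auto simp: R_def doubleton_eq_iff)
  then have outer': "{x, a} \<in> E'" "{c, y} \<in> E'" using edges by (auto simp: E')
  have RE: "R \<subseteq> E" using edges leaf_inc by (auto simp: R_def)
  have E'E: "E' \<subseteq> E" by (auto simp: E')
  have l'0: "l' e \<noteq> 0" if "e \<in> E'" for e using l'(1)[OF that] L E'E that by force
  have LR: "card (L e) = 4 \<and> 0 \<notin> L e"
    if "e \<in> {{a, b}, {b, c}} \<union> leaf_edges E a \<union> leaf_edges E b \<union> leaf_edges E c" for e
    using L RE that unfolding R_def by blast
  obtain g where g: "\<And>e. e \<in> {{a, b}, {b, c}} \<union> leaf_edges E a \<union> leaf_edges E b \<union> leaf_edges E c \<Longrightarrow> g e \<in> L e"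
    and gs: "l' {x, a} * g {a, b} * prod g (leaf_edges E a) \<noteq> edge_prod E' l' x"
    "l' {x, a} * g {a, b} * prod g (leaf_edges E a) \<noteq> g {a, b} * g {b, c} * prod g (leaf_edges E b)"
    "g {a, b} * g {b, c} * prod g (leaf_edges E b) \<noteq> l' {c, y} * g {b, c} * prod g (leaf_edges E c)"
    "l' {c, y} * g {b, c} * prod g (leaf_edges E c) \<noteq> edge_prod E' l' y"
    and ga: "\<And>e. e \<in> leaf_edges E a \<Longrightarrow> l' {x, a} * g {a, b} * prod g (leaf_edges E a) \<noteq> g e"
    and gb: "\<And>e. e \<in> leaf_edges E b \<Longrightarrow> g {a, b} * g {b, c} * prod g (leaf_edges E b) \<noteq> g e"
    and gc: "\<And>e. e \<in> leaf_edges E c \<Longrightarrow> l' {c, y} * g {b, c} * prod g (leaf_edges E c) \<noteq> g e"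
    by (rule thread_choice[where A = L and ab = "{a, b}" and bc = "{b, c}" and e = "l' {x, a}"
          and f = "l' {c, y}" and s = "edge_prod E' l' x" and t = "edge_prod E' l' y",
          OF finR finR finR le1 dis ne _ _ LR l'0[OF outer'(1)] l'0[OF outer'(2)]])
      (use no_leaf nab in auto)
  define l where "l e = (if e \<in> R then g e else l' e)" for e
  have lR: "l e = g e" if "e \<in> R" for e using that by (simp add: l_def)
  have lE': "l e = l' e" if "e \<in> E'" for e using that by (auto simp: l_def E')
  have lL: "l e \<in> L e" if "e \<in> E" for e
    using that g l'(1) by (auto simp: l_def E' R_def)
  have leafR: "prod l (leaf_edges E w) = prod g (leaf_edges E w)" if "w \<in> {a, b, c}" for w
    using that lR by (intro prod.cong) (auto simp: R_def)
  have xa_ab: "{x, a} \<noteq> {a, b}" and bc_cy: "{b, c} \<noteq> {c, y}" using abc by (auto simp: doubleton_eq_iff)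
  have inR: "{a, b} \<in> R" "{b, c} \<in> R" by (auto simp: R_def)
  have pa: "edge_prod E l a = l' {x, a} * g {a, b} * prod g (leaf_edges E a)"
    unfolding edge_prod_def inc(1)
    using no_leaf xa_ab finR lR inR lE' outer' leafR by (simp add: prod.union_disjoint)
  have pb: "edge_prod E l b = g {a, b} * g {b, c} * prod g (leaf_edges E b)"
    unfolding edge_prod_def inc(2)
    using no_leaf ne finR lR inR leafR by (simp add: prod.union_disjoint)
  have pc: "edge_prod E l c = l' {c, y} * g {b, c} * prod g (leaf_edges E c)"
    unfolding edge_prod_def inc(3)
    using no_leaf bc_cy finR lR inR lE' outer' leafR by (simp add: prod.union_disjoint)
  have leaf_prod: "edge_prod E l z = g {w, z}" if "{w, z} \<in> leaf_edges E w" "w \<in> {a, b, c}" for w z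
    using leafD(1)[OF that(1)] that lR[of "{w, z}"] by (auto simp: edge_prod_def R_def)
  have touch: "inc E z \<subseteq> R" if z: "z \<notin> {a, b, c}" "k \<in> inc E z" "k \<in> R" for z k
  proof -
    have zk: "z \<in> k" using z by (simp add: inc_def)
    then obtain w where w: "w \<in> {a, b, c}" "k \<in> leaf_edges E w" using z by (auto simp: R_def)
    then have "k = {w, z}" using leaf_end[of k w] zk z(1) by auto
    then have "inc E z = {k}" using leafD(1)[of w z] w(2) by simp
    then show ?thesis using z(3) by simp
  qed
  have untouched: "inc E z = inc E' z" if "z \<notin> {a, b, c}" "k \<in> inc E z" "k \<notin> R" for z k
  proof -
    have "inc E z \<inter> R = {}" using touch[of z] that by blast
    then show ?thesis by (auto simp: E' inc_def)
  qed
  have same: "edge_prod E l z = edge_prod E' l' z" if "z \<notin> {a, b, c}" "k \<in> inc E z" "k \<notin> R" for z k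
    using untouched[OF that] lE' by (intro edge_prod_cong) (auto simp: inc_def)
  have px: "edge_prod E l x = edge_prod E' l' x"
    using same[of x "{x, a}"] abc outer(1) edges by (simp add: inc_def)
  have py: "edge_prod E l y = edge_prod E' l' y"
    using same[of y "{c, y}"] abc outer(2) edges by (simp add: inc_def)
  have at_a: "edge_prod E l a \<noteq> edge_prod E l z" if z: "{a, z} \<in> E" "z \<noteq> a" for z
  proof -
    have "{a, z} \<in> inc E a" using z by (simp add: inc_def)
    then consider "z = x" | "z = b" | "{a, z} \<in> leaf_edges E a"
      unfolding inc(1) using z(2) by (auto simp: doubleton_eq_iff)
    then show ?thesis
    proof cases
      case 3 then show ?thesis using ga[OF 3] leaf_prod[OF 3] pa by simp
    qed (use pa pb px gs in simp_all)
  qed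
  have at_b: "edge_prod E l b \<noteq> edge_prod E l z" if z: "{b, z} \<in> E" "z \<noteq> b" for z
  proof -
    have "{b, z} \<in> inc E b" using z by (simp add: inc_def)
    then consider "z = a" | "z = c" | "{b, z} \<in> leaf_edges E b"
      unfolding inc(2) using z(2) by (auto simp: doubleton_eq_iff)
    then show ?thesis
    proof cases
      case 1 then show ?thesis using pa pb gs(2) by simp
    next
      case 2 then show ?thesis using pc pb gs(3) by simp
    next
      case 3 then show ?thesis using gb[OF 3] leaf_prod[OF 3] pb by simp
    qed
  qed
  have at_c: "edge_prod E l c \<noteq> edge_prod E l z" if z: "{c, z} \<in> E" "z \<noteq> c" for z
  proof -
    have "{c, z} \<in> inc E c" using z by (simp add: inc_def)
    then consider "z = b" | "z = y" | "{c, z} \<in> leaf_edges E c"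
      unfolding inc(3) using z(2) by (auto simp: doubleton_eq_iff)
    then show ?thesis
    proof cases
      case 1 then show ?thesis using pc pb gs(3) by simp
    next
      case 2 then show ?thesis using pc py gs(4) by simp
    next
      case 3 then show ?thesis using gc[OF 3] leaf_prod[OF 3] pc by simp
    qed
  qed
  have at: "edge_prod E l w \<noteq> edge_prod E l z" if "{w, z} \<in> E" "z \<noteq> w" "w \<in> {a, b, c}" for w z
    using that at_a at_b at_c by blast
  have "weakly_proper E l"
    unfolding weakly_proper_def
  proof (intro allI impI)
    fix u v assume uv: "{u, v} \<in> E" "inc E u \<noteq> {{u, v}} \<or> inc E v \<noteq> {{u, v}}"
    have "u \<noteq> v" using card2[OF uv(1)] by auto
    show "edge_prod E l u \<noteq> edge_prod E l v"
    proof (cases "u \<in> {a, b, c} \<or> v \<in> {a, b, c}")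
      case True
      then show ?thesis using at[of u v] at[of v u] uv(1) \<open>u \<noteq> v\<close> by (auto simp: insert_commute)
    next
      case False
      then have uv': "u \<notin> {a, b, c}" "v \<notin> {a, b, c}" by auto
      have n: "{u, v} \<notin> R" using uv' leaf_inc(2)[of "{u, v}"] by (auto simp: R_def doubleton_eq_iff)
      have k: "{u, v} \<in> inc E u" "{u, v} \<in> inc E v" using uv by (auto simp: inc_def)
      have "{u, v} \<in> E'" using n uv by (simp add: E')
      then have "edge_prod E' l' u \<noteq> edge_prod E' l' v"
        using l'(2) uv(2) untouched[OF uv'(1) k(1) n] untouched[OF uv'(2) k(2) n]
        unfolding weakly_proper_def by metis
      then show ?thesis using same[OF uv'(1) k(1) n] same[OF uv'(2) k(2) n] by simp
    qed
  qed
  then show ?thesis using lL by blast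
qed

section \<open>Labelling plane graphs of large girth\<close>

lemma finite_edge_sets:
  assumes "finite E"
  shows "finite (core_edges E w)" "finite (leaf_edges E w)" "finite (pendant_edges E w)"
    and "core_edges E w \<subseteq> inc E w" "leaf_edges E w \<subseteq> inc E w" "pendant_edges E w \<subseteq> inc E w"
proof -
  show s: "core_edges E w \<subseteq> inc E w" "leaf_edges E w \<subseteq> inc E w" "pendant_edges E w \<subseteq> inc E w"
    by (auto simp: core_edges_def leaf_edges_def pendant_edges_def)
  show "finite (core_edges E w)" "finite (leaf_edges E w)" "finite (pendant_edges E w)"
    using s assms finite_subset finite_inc by metis+
qed

lemma inc_core_leaf: "pendant_edges E w = {} \<Longrightarrow> inc E w = core_edges E w \<union> leaf_edges E w"
  by (auto simp: core_edges_def leaf_edges_def)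

lemma edge_other_end:
  assumes "card e = 2" "w \<in> e"
  obtains m where "e = {w, m}" "m \<noteq> w"
  using assms by (auto simp: card_2_iff)

text \<open>With one core edge and one leaf edge, \<open>u\<close> has no further edges, so seen
  from the far end of the core edge it is the middle of a pendant path.\<close>

lemma pendant_edgeI:
  assumes fin: "finite E" and card2: "\<And>e. e \<in> E \<Longrightarrow> card e = 2"
    and u: "pendant_edges E u = {}" "card (core_edges E u) \<le> 1" "card (leaf_edges E u) \<le> 1"
    and e: "e \<in> core_edges E u" "leaf_edges E u \<noteq> {}"
  obtains w where "e \<in> pendant_edges E w" "e = {u, w}" "w \<noteq> u"
proof -
  have "e \<in> E" "u \<in> e" using e(1) by (auto simp: core_edges_def inc_def)
  then obtain w where w: "e = {u, w}" "w \<noteq> u" using edge_other_end card2 by metis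
  obtain r where r: "r \<in> leaf_edges E u" using e(2) by auto
  then obtain z where z: "r = {u, z}" "z \<noteq> u" "inc E z = {r}" by (auto simp: leaf_edges_def)
  have "core_edges E u = {e}" "leaf_edges E u = {r}"
    using u(2,3) e(1) r finite_edge_sets[OF fin, of u] by (auto simp: card_le_Suc0_iff_eq)
  then have incu: "inc E u = {e, r}" using inc_core_leaf[OF u(1)] by auto
  have "r \<noteq> e" using e(1) r by (auto simp: core_edges_def)
  then have "z \<noteq> w" using z w by auto
  moreover have "e \<in> inc E w" using \<open>e \<in> E\<close> w by (simp add: inc_def)
  ultimately have "e \<in> pendant_edges E w"
    using w z incu unfolding pendant_edges_def by blast
  then show thesis using that w by blast
qed

text \<open>One round of stripping suffices: if the far end \<open>m\<close> of a core edge had no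
  second core edge, it would have no other edge at all or just one leaf edge, and the edge would
  have been stripped as a leaf edge or a pendant edge.\<close>

lemma core_subgraph:
  fixes E :: "'a set set"
  assumes fin: "finite E" and card2: "\<And>e. e \<in> E \<Longrightarrow> card e = 2"
    and few: "\<And>w. card (core_edges E w) \<le> 2 \<Longrightarrow> card (leaf_edges E w) \<le> 1 \<and> pendant_edges E w = {}"
    and U: "U = {w. 2 \<le> card (core_edges E w)}" and K: "K = {e \<in> E. e \<subseteq> U}" and w: "w \<in> U"
  shows "inc K w = core_edges E w"
proof (intro equalityI subsetI)
  fix e assume "e \<in> inc K w"
  then have e: "e \<in> E" "e \<subseteq> U" "w \<in> e" by (auto simp: inc_def K)
  have notU: "v \<notin> U" if "core_edges E v \<subseteq> {f}" for v f
    using card_mono[OF _ that] by (auto simp: U)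
  have "e \<notin> leaf_edges E w"
  proof
    assume "e \<in> leaf_edges E w"
    then obtain v where "v \<in> e" "inc E v = {e}" by (auto simp: leaf_edges_def)
    then show False using notU[of v e] e(2) by (auto simp: core_edges_def)
  qed
  moreover have "e \<notin> pendant_edges E w"
  proof
    assume "e \<in> pendant_edges E w"
    then obtain u v where uv: "e = {w, u}" "v \<noteq> u" "inc E u = {e, {u, v}}" "inc E v = {{u, v}}"
      by (auto simp: pendant_edges_def)
    then have "{u, v} \<in> leaf_edges E u" by (auto simp: leaf_edges_def)
    then have "core_edges E u \<subseteq> {e}" using uv by (auto simp: core_edges_def)
    then show False using notU[of u e] e(2) uv(1) by auto
  qed
  ultimately show "e \<in> core_edges E w" using e by (simp add: core_edges_def inc_def)
next
  fix e assume e: "e \<in> core_edges E w"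
  then have eE: "e \<in> E" "w \<in> e" by (auto simp: core_edges_def inc_def)
  then obtain m where m: "e = {w, m}" "m \<noteq> w" using edge_other_end card2 by metis
  have em: "e \<in> inc E m" using eE m by (simp add: inc_def)
  have "m \<in> U"
  proof (rule ccontr)
    assume "m \<notin> U"
    then have m1: "card (core_edges E m) \<le> 1" by (simp add: U)
    then have m2: "card (leaf_edges E m) \<le> 1" "pendant_edges E m = {}" using few[of m] by auto
    have "e \<notin> leaf_edges E m"
    proof
      assume "e \<in> leaf_edges E m"
      then have "inc E w = {e}" using m by (auto simp: leaf_edges_def doubleton_eq_iff)
      then have "card (core_edges E w) \<le> card {e}"
        using finite_edge_sets(4)[OF fin, of w] by (intro card_mono) auto
      then show False using w by (simp add: U)
    qed
    then have ec: "e \<in> core_edges E m" using em inc_core_leaf[OF m2(2)] by auto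
    show False
    proof (cases "leaf_edges E m = {}")
      case True
      then have "inc E m = core_edges E m" using inc_core_leaf[OF m2(2)] by simp
      moreover have "core_edges E m = {e}"
        using m1 ec finite_edge_sets[OF fin, of m] by (auto simp: card_le_Suc0_iff_eq)
      ultimately have "inc E m = {e}" by simp
      then have "e \<in> leaf_edges E w" using m eE by (auto simp: leaf_edges_def inc_def)
      then show False using e by (simp add: core_edges_def)
    next
      case False
      obtain w' where "e \<in> pendant_edges E w'" "e = {m, w'}" "w' \<noteq> m"
        using pendant_edgeI[OF fin card2 m2(2) m1 m2(1) ec False] by blast
      moreover from this have "w' = w" using m by (auto simp: doubleton_eq_iff)
      ultimately show False using e by (simp add: core_edges_def)
    qed
  qed
  then show "e \<in> inc K w" using eE m w by (auto simp: inc_def K)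
qed

text \<open>Without a vertex of core degree two, \<open>u\<close> has at most one core edge and one
  leaf edge. Having two edges, it has exactly one of each, which makes a pendant path, and
  \<open>few\<close> allows none.\<close>

lemma core_nonempty:
  fixes E :: "'a set set"
  assumes fin: "finite E" and card2: "\<And>e. e \<in> E \<Longrightarrow> card e = 2"
    and few: "\<And>w. card (core_edges E w) \<le> 2 \<Longrightarrow> card (leaf_edges E w) \<le> 1 \<and> pendant_edges E w = {}"
    and uv: "{u, v} \<in> E" "inc E u \<noteq> {{u, v}}"
  shows "\<exists>w. 2 \<le> card (core_edges E w)"
proof (rule ccontr)
  assume none: "\<not> ?thesis"
  have core1: "card (core_edges E w) \<le> 1" for w
  proof -
    have "\<not> 2 \<le> card (core_edges E w)" using none by blast
    then show ?thesis by linarith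
  qed
  have f: "card (leaf_edges E w) \<le> 1" "pendant_edges E w = {}" for w
    using few[of w] core1[of w] by auto
  have incu: "inc E u = core_edges E u \<union> leaf_edges E u" by (rule inc_core_leaf[OF f(2)])
  have uvu: "{u, v} \<in> inc E u" using uv by (simp add: inc_def)
  then obtain k where k: "k \<in> inc E u" "k \<noteq> {u, v}" using uv(2) by blast
  have "\<forall>e\<in>leaf_edges E u. \<forall>e'\<in>leaf_edges E u. e = e'" "\<forall>e\<in>core_edges E u. \<forall>e'\<in>core_edges E u. e = e'"
    using f(1)[of u] core1[of u] finite_edge_sets[OF fin, of u]
    by (simp_all add: card_le_Suc0_iff_eq)
  then have "\<not> inc E u \<subseteq> leaf_edges E u" "\<not> inc E u \<subseteq> core_edges E u" 
    using k uvu by (metis subsetD)+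
  then obtain e where "e \<in> core_edges E u" "leaf_edges E u \<noteq> {}" using incu by blast
  then show False using pendant_edgeI[OF fin card2 f(2) core1 f(1)] f(2) by blast
qed

text \<open>Only the edge set varies in the induction; drawing and girth are always those of
  \<open>G\<close>, because a cycle in a subset is a cycle of \<open>G\<close>.\<close>

lemma (in plane_graph) weakly_proper_labelling:
  assumes "E \<subseteq> edges G" and "\<And>c. cycle_in (edges G) c \<Longrightarrow> 16 \<le> length c"
    and "\<And>e. e \<in> edges G \<Longrightarrow> card (L e) = 4 \<and> 0 \<notin> L e"
  shows "\<exists>l. (\<forall>e\<in>E. l e \<in> L e) \<and> weakly_proper E l"
  using assms(1)
proof (induction "card E" arbitrary: E rule: less_induct)
  case less
  have fin: "finite E" using finite_subset[OF less.prems finite_edges] .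
  have card2: "card e = 2" if "e \<in> E" for e using that less.prems edge_card by blast
  have L: "card (L e) = 4 \<and> 0 \<notin> L e" if "e \<in> E" for e using that less.prems assms(3) by blast
  have smaller: "\<exists>l. (\<forall>e\<in>E'. l e \<in> L e) \<and> weakly_proper E' l" if "E' \<subset> E" for E'
    using less.hyps[of E'] that less.prems psubset_card_mono[OF fin that] by blast
  show ?case
  proof (cases "\<exists>w. card (core_edges E w) \<le> 2 \<and> (2 \<le> card (leaf_edges E w) \<or> pendant_edges E w \<noteq> {})")
    case True
    then obtain w where w: "card (core_edges E w) \<le> 2"
      "2 \<le> card (leaf_edges E w) \<or> pendant_edges E w \<noteq> {}" by blast
    define R3 where "R3 = {f \<in> E. w \<notin> f \<and> (\<exists>e\<in>pendant_edges E w. e \<inter> f \<noteq> {})}"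
    define E' where "E' = E - leaf_edges E w - pendant_edges E w - R3"
    have "leaf_edges E w \<union> pendant_edges E w \<noteq> {}" using w(2) by auto
    moreover have "leaf_edges E w \<union> pendant_edges E w \<subseteq> E"
      by (auto simp: leaf_edges_def pendant_edges_def inc_def)
    ultimately have "E' \<subset> E" unfolding E'_def by blast
    then obtain l' where l': "\<forall>e\<in>E'. l' e \<in> L e" "weakly_proper E' l'" using smaller by blast
    show ?thesis
      using branch_reduction[where L = L, OF fin card2 L w R3_def E'_def _ l'(2)] l'(1) by blast
  next
    case False
    then have few: "card (leaf_edges E w) \<le> 1 \<and> pendant_edges E w = {}"
      if "card (core_edges E w) \<le> 2" for w using that by fastforce
    define U where "U = {w. 2 \<le> card (core_edges E w)}"
    define K where "K = {e \<in> E. e \<subseteq> U}"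
    have KE: "K \<subseteq> E" by (auto simp: K_def)
    have core: "inc K w = core_edges E w" if "w \<in> U" for w
      using core_subgraph[OF fin card2 few U_def K_def that] .
    show ?thesis
    proof (cases "U = {}")
      case True
      \<comment> \<open>Every edge is isolated here, so any choice from the lists is weakly
        proper.\<close>
      have iso: "inc E u = {{u, v}}" if "{u, v} \<in> E" for u v
        using core_nonempty[OF fin card2 few that] True unfolding U_def by blast
      have "weakly_proper E l" for l
        unfolding weakly_proper_def
      proof (intro allI impI)
        fix u v assume "{u, v} \<in> E" "inc E u \<noteq> {{u, v}} \<or> inc E v \<noteq> {{u, v}}"
        then show "edge_prod E l u \<noteq> edge_prod E l v"
          using iso[of u v] iso[of v u] by (simp add: insert_commute)
      qed
      moreover have "\<forall>e\<in>E. \<exists>x. x \<in> L e" 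
      proof
        fix e assume "e \<in> E"
        then have "L e \<noteq> {}" using L[of e] by auto
        then show "\<exists>x. x \<in> L e" by blast
      qed
      ultimately show ?thesis using bchoice[of E "\<lambda>e x. x \<in> L e"] by blast
    next
      case False
      then obtain w where w: "w \<in> U" by auto
      then have "inc K w \<noteq> {}" using core[OF w] by (auto simp: U_def)
      then have "K \<noteq> {}" by (auto simp: inc_def)
      have KU: "\<Union> K \<subseteq> U" by (auto simp: K_def)
      have long: "16 \<le> length c" if "cycle_in K c" for c
        using assms(2) cycle_in_mono[OF that] KE less.prems by blast
      have deg: "2 \<le> card (inc K v)" if "v \<in> \<Union> K" for v
        using core[of v] that KU by (auto simp: U_def)
      have KG: "K \<subseteq> edges G" using KE less.prems by (rule subset_trans)
      obtain a b c where abc: "{a, b} \<in> K" "{b, c} \<in> K" "a \<noteq> c"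
        "card (inc K a) = 2" "card (inc K b) = 2" "card (inc K c) = 2"
        by (rule three_consecutive_degree_two[OF KG \<open>K \<noteq> {}\<close> deg long])
      have ab: "a \<noteq> b" "b \<noteq> c" using card2[of "{a, b}"] card2[of "{b, c}"] abc KE by auto
      have inU: "a \<in> U" "b \<in> U" "c \<in> U" using abc KU by auto
      have two: "card (core_edges E v) = 2" if "v \<in> {a, b, c}" for v
        using that core inU abc by auto
      have leaf: "card (leaf_edges E v) \<le> 1" "inc E v = inc K v \<union> leaf_edges E v"
        "inc K v \<inter> leaf_edges E v = {}" if v: "v \<in> {a, b, c}" for v
      proof -
        have "v \<in> U" using v inU by auto
        have p: "card (leaf_edges E v) \<le> 1" "pendant_edges E v = {}" using few[of v] two[OF v] by auto
        show "card (leaf_edges E v) \<le> 1" by fact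
        show "inc E v = inc K v \<union> leaf_edges E v" using inc_core_leaf[OF p(2)] core[OF \<open>v \<in> U\<close>] by simp
        show "inc K v \<inter> leaf_edges E v = {}" using core[OF \<open>v \<in> U\<close>] by (auto simp: core_edges_def)
      qed
      \<comment> \<open>The girth rules out a triangle on \<open>a\<close>, \<open>b\<close>,
        \<open>c\<close>; this is what places \<open>x\<close> and \<open>y\<close> outside these
        three vertices.\<close>
      have "{a, c} \<notin> K"
      proof
        assume "{a, c} \<in> K"
        then have "cycle_in K [a, b, c]"
          using abc ab by (auto simp: cycle_in_def cycle_edges_def insert_commute)
        then show False using long by fastforce
      qed
      have other: "\<exists>x. inc K v = {{x, v}, {v, u}} \<and> x \<noteq> v \<and> x \<noteq> u"
        if v: "card (inc K v) = 2" "{v, u} \<in> K" for v u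
      proof -
        have vu: "{v, u} \<in> inc K v" using v(2) by (simp add: inc_def)
        then have "card (inc K v - {{v, u}}) = 1" using v(1) by simp
        then obtain k where k: "inc K v - {{v, u}} = {k}" by (auto simp: card_1_singleton_iff)
        then have "k \<in> inc K v - {{v, u}}" by simp
        then have k': "k \<in> K" "v \<in> k" "k \<noteq> {v, u}" by (simp_all add: inc_def)
        have "k \<in> E" using k'(1) KE by (rule rev_subsetD)
        then obtain x where x: "k = {v, x}" "x \<noteq> v" using edge_other_end[OF card2 k'(2)] by metis
        have "inc K v = insert {v, u} (inc K v - {{v, u}})" using insert_Diff[OF vu] by (rule sym)
        also have "\<dots> = {{v, x}, {v, u}}" unfolding k x(1) by (rule insert_commute)
        finally have "inc K v = {{v, x}, {v, u}}" .
        moreover have "{v, x} = {x, v}" by (rule insert_commute)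
        moreover have "x \<noteq> u" using k'(3) x(1) by auto
        ultimately show ?thesis using x(2) by metis
      qed
      obtain x where x: "inc K a = {{x, a}, {a, b}}" "x \<noteq> a" "x \<noteq> b" using other[OF abc(4,1)] by blast
      have "{c, b} \<in> K" using abc(2) by (simp add: insert_commute)
      then obtain y where y: "inc K c = {{y, c}, {c, b}}" "y \<noteq> c" "y \<noteq> b" using other[OF abc(6)] by blast
      have "{x, a} \<in> inc K a" "{y, c} \<in> inc K c" using x(1) y(1) by auto
      then have "{x, a} \<in> K" "{y, c} \<in> K" by (auto simp: inc_def)
      then have "x \<noteq> c" "y \<noteq> a" using \<open>{a, c} \<notin> K\<close> by (auto simp: insert_commute)
      then have xy: "x \<notin> {a, b, c}" "y \<notin> {a, b, c}" using x y by auto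
      have "{a, b} \<noteq> {b, c}" using abc(3) ab by (auto simp: doubleton_eq_iff)
      moreover have "{{a, b}, {b, c}} \<subseteq> inc K b" using abc by (auto simp: inc_def)
      moreover have "finite (inc K b)" using finite_subset[OF KE fin] by simp
      ultimately have incb: "inc K b = {{a, b}, {b, c}}"
        using abc(5) by (intro card_seteq[symmetric]) auto
      have incc: "inc K c = {{b, c}, {c, y}}" using y(1) by (simp add: insert_commute)
      define E' where "E' = E - ({{a, b}, {b, c}} \<union> leaf_edges E a \<union> leaf_edges E b \<union> leaf_edges E c)"
      have "E' \<subset> E" using abc KE unfolding E'_def by blast
      then obtain l' where l': "\<forall>e\<in>E'. l' e \<in> L e" "weakly_proper E' l'" using smaller by blast
      have la: "inc E a = {{x, a}, {a, b}} \<union> leaf_edges E a" "card (leaf_edges E a) \<le> 1"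
        "{x, a} \<notin> leaf_edges E a" "{a, b} \<notin> leaf_edges E a" using leaf[of a] x(1) by auto
      have lb: "inc E b = {{a, b}, {b, c}} \<union> leaf_edges E b" "card (leaf_edges E b) \<le> 1"
        "{a, b} \<notin> leaf_edges E b" "{b, c} \<notin> leaf_edges E b" using leaf[of b] incb by auto
      have lc: "inc E c = {{b, c}, {c, y}} \<union> leaf_edges E c" "card (leaf_edges E c) \<le> 1"
        "{b, c} \<notin> leaf_edges E c" "{c, y} \<notin> leaf_edges E c" using leaf[of c] incc by auto
      show ?thesis
        using thread_reduction[where L = L, OF fin card2 L ab abc(3) xy la(1) lb(1) lc(1) la(3,4) lb(3,4) lc(3,4)
            la(2) lb(2) lc(2) E'_def _ l'(2)] l'(1) by blast
    qed
  qed
qed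

section \<open>Back to nice graphs and vertex products\<close>

lemma vertex_product_eq_edge_prod:
  assumes "simple_graph G"
  shows "vertex_product G l v = edge_prod (edges G) l v"
proof -
  have "inj_on (\<lambda>w. {v, w}) (neighbours G v)" by (auto simp: inj_on_def doubleton_eq_iff)
  moreover have "(\<lambda>w. {v, w}) ` neighbours G v = inc (edges G) v"
  proof (intro equalityI subsetI)
    fix e assume e: "e \<in> inc (edges G) v"
    then have "card e = 2" "v \<in> e" using assms by (auto simp: inc_def simple_graph_def)
    then obtain w where "e = {v, w}" using edge_other_end by metis
    then show "e \<in> (\<lambda>w. {v, w}) ` neighbours G v" using e by (auto simp: inc_def neighbours_def)
  qed (auto simp: inc_def neighbours_def)
  ultimately show ?thesis
    unfolding vertex_product_def edge_prod_def
    by (metis (no_types, lifting) prod.reindex_cong)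
qed

text \<open>In a nice graph no edge falls under the exemption in \<open>weakly_proper\<close>: the
  component of \<open>u\<close> would consist of \<open>u\<close> and \<open>v\<close> alone and be
  a copy of \<open>complete_graph 2\<close>.\<close>

lemma nice_no_isolated_edge:
  assumes simple: "simple_graph G" and nice: "nice G" and uv: "{u, v} \<in> edges G"
    and iso: "inc (edges G) u = {{u, v}}" "inc (edges G) v = {{u, v}}"
  shows False
proof -
  have card2: "card {u, v} = 2" and sub: "{u, v} \<subseteq> verts G"
    using simple uv by (auto simp: simple_graph_def)
  have ne: "u \<noteq> v" using card2 by auto
  let ?r = "{(x, y). {x, y} \<in> edges G}"
  have "w \<in> {u, v}" if "(u, w) \<in> ?r\<^sup>*" for w
    using that
  proof (induction rule: rtrancl_induct)
    case (step y z)
    then have "{y, z} \<in> inc (edges G) y" by (auto simp: inc_def)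
    then have "{y, z} = {u, v}" using step.IH iso by auto
    then show ?case by auto
  qed simp
  moreover have "(u, v) \<in> ?r\<^sup>*" using uv by auto
  ultimately have reach: "{w. (u, w) \<in> ?r\<^sup>*} = {u, v}" by auto
  have "graph_iso (component_of G u) (complete_graph 2)"
    unfolding graph_iso_def
  proof (intro exI conjI ballI)
    let ?f = "\<lambda>w. if w = u then 0 else 1 :: nat"
    have V: "verts (component_of G u) = {u, v}" and Ec: "edges (component_of G u) = {e \<in> edges G. e \<subseteq> {u, v}}"
      by (simp_all add: component_of_def induced_subgraph_def reach)
    have V2: "verts (complete_graph 2) = {0, 1}" by (auto simp: complete_graph_def)
    show "bij_betw ?f (verts (component_of G u)) (verts (complete_graph 2))"
      unfolding V V2 using ne by (auto simp: bij_betw_def inj_on_def)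
    fix a b assume "a \<in> verts (component_of G u)" "b \<in> verts (component_of G u)"
    then have ab: "a \<in> {u, v}" "b \<in> {u, v}" using V by auto
    have "{a, a} \<notin> edges G" for a using simple by (auto simp: simple_graph_def)
    then have "{a, b} \<in> edges (component_of G u) \<longleftrightarrow> a \<noteq> b"
      unfolding Ec using ab uv by (auto simp: insert_commute)
    moreover have "{?f a, ?f b} \<in> edges (complete_graph 2) \<longleftrightarrow> a \<noteq> b"
      using ab ne by (auto simp: complete_graph_def)
    ultimately show "{a, b} \<in> edges (component_of G u) \<longleftrightarrow> {?f a, ?f b} \<in> edges (complete_graph 2)" by simp
  qed
  then show False using nice sub by (auto simp: nice_def components_of_graph_def)
qed

lemma cycle_in_imp_is_cycle:
  assumes "simple_graph G" "cycle_in (edges G) c"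
  shows "is_cycle G c"
proof -
  have c: "distinct c" "3 \<le> length c" "{last c, hd c} \<in> edges G" "path_edges c \<subseteq> edges G"
    using assms(2) by (auto simp: cycle_in_def cycle_edges_def)
  then have ne: "c \<noteq> []" by auto
  have edge: "{c ! i, c ! (Suc i mod length c)} \<in> edges G" if i: "i < length c" for i
  proof (cases "Suc i < length c")
    case True
    then show ?thesis using c(4) by (auto simp: path_edges_conv_nth)
  next
    case False
    then have "Suc i = length c" using i by simp
    then have "c ! i = last c" "c ! (Suc i mod length c) = hd c"
      using ne by (auto simp: last_conv_nth hd_conv_nth simp flip: \<open>Suc i = length c\<close>)
    then show ?thesis using c(3) by simp
  qed
  have "set c \<subseteq> verts G"
  proof
    fix v assume "v \<in> set c"
    then obtain i where "i < length c" "c ! i = v" by (auto simp: in_set_conv_nth)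
    then have "v \<in> {c ! i, c ! (Suc i mod length c)}" by simp
    then show "v \<in> verts G" using edge[OF \<open>i < length c\<close>] assms(1) by (auto simp: simple_graph_def)
  qed
  then show ?thesis using c edge by (simp add: is_cycle_def)
qed

theorem theorem3p8:
  fixes G :: "'a ugraph"
  assumes "simple_graph G"
    and "nice G"
    and "planar G"
    and "girth G \<ge> 16"
  shows "ch_prod_nonzero G \<le> 4"
proof -
  obtain p \<gamma> where "plane_drawing G p \<gamma>" using assms(3) by (auto simp: planar_def)
  then interpret plane_graph G p \<gamma> using assms(1) by unfold_locales
  have long: "16 \<le> length c" if "cycle_in (edges G) c" for c
  proof -
    have "girth G \<le> enat (length c)"
      unfolding girth_def using cycle_in_imp_is_cycle[OF assms(1) that] by (intro Inf_lower) blast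
    then have "16 \<le> enat (length c)" using assms(4) by (rule order_trans[rotated])
    then show ?thesis by (simp add: numeral_eq_enat)
  qed
  have "\<exists>l. list_labelling G L l \<and> p_proper G l"
    if L: "list_assignment G 4 L" "\<forall>e\<in>edges G. 0 \<notin> L e" for L
  proof -
    obtain l where l: "\<forall>e\<in>edges G. l e \<in> L e" "weakly_proper (edges G) l"
      using weakly_proper_labelling[OF order_refl long, of L] L by (auto simp: list_assignment_def)
    have "p_proper G l"
      unfolding p_proper_def vertex_product_eq_edge_prod[OF assms(1)]
    proof (intro allI impI)
      fix u v assume uv: "{u, v} \<in> edges G"
      then have "inc (edges G) u \<noteq> {{u, v}} \<or> inc (edges G) v \<noteq> {{u, v}}"
        using nice_no_isolated_edge[OF assms(1,2) uv] by metis
      then show "edge_prod (edges G) l u \<noteq> edge_prod (edges G) l v"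
        using l(2) uv by (simp add: weakly_proper_def)
    qed
    then show ?thesis using l(1) by (auto simp: list_labelling_def)
  qed
  then have "ch_prod_nonzero G \<le> enat 4"
    unfolding ch_prod_nonzero_def by (intro Inf_lower) auto
  then show ?thesis by (simp add: numeral_eq_enat)
qed

end
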